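(* For every prime power $q>7$, $M(q,q-5)\ge \mathcal{S}_5(q)$, where $$\mathcal{S}_5(q)=\begin{cases} \frac12(q^4+q^3+q^2-3q), & q\equiv 0 \pmod 3,\\ \frac12(q^4+q^2-2q), & q \text{ odd},\ q\equiv 1\pmod 3,\\ \frac12(q^4+3q^2-4q), & q \text{ even},\ q\equiv 1\pmod 3,\\ \frac12(q^4+2q^3-q^2-2q), & q \text{ odd},\ q\equiv 2\pmod 3,\\ \frac12(q^4+2q^3+q^2-4q), & q \text{ even},\ q\equiv 2\pmod 3. \end{cases}$$
   Context: For permutations $\pi,\sigma$ of the same $n$ symbols, the Hamming distance $hd(\pi,\sigma)$ is the number of positions $x$ with $\pi(x)\ne\sigma(x)$. $M(n,D)$ is the maximum size of a set of permutations on $n$ symbols in which any two distinct permutations have Hamming distance at least $D$. Let $q$ be a prime power, $\mathbb{F}_q$ the field with $q$ elements and $\mathcal{P}^1(\mathbb{F}_q)=\mathbb{F}_q\cup\{\infty\}$. Let $V,U$ be nonzero polynomials over $\mathbb{F}_q$ with $\gcd(V,U)=1$, of degrees $v,u$ and leading coefficients $a_v,b_u$. The rational function $V(x)/U(x)$ is evaluated on $\mathcal{P}^1(\mathbb{F}_q)$ as follows: at $a\in\mathbb{F}_q$ its value is $V(a)/U(a)$, understood as $\infty$ if $U(a)=0$; at $\infty$ its value is $\infty$ if $v>u$, $0$ if $v<u$, and $a_v/b_v$ if $v=u$. It is a permutation rational function (PRF) if it permutes $\mathcal{P}^1(\mathbb{F}_q)$. $P_{v,u}(q)$ is the set of PRFs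 $V(x)/U(x)$ (as rational functions, so $V/U$ and $(cV)/(cU)$ with $c\in\mathbb{F}_q\setminus\{0\}$ are the same element) with $\deg V=v$ and $\deg U=u$, and $N_{v,u}(q)=|P_{v,u}(q)|$. For odd $d$, $\mathcal{S}_d(q)=\sum N_{v,u}(q)$, the sum being over all pairs $(v,u)$ of non-negative integers such that: $v\le (d+1)/2$ if $v>u$; $u\le (d-3)/2$ if $v<u$; and $v=u\le (d-3)/2$ if $v=u$. *)

theory Defs
  imports
    "HOL-Computational_Algebra.Polynomial"
    "HOL-Computational_Algebra.Fraction_Field"
    "HOL-Number_Theory.Prime_Powers"
    "HOL-Combinatorics.Permutations"
begin

definition hamming_dist :: "'b set \<Rightarrow> ('b \<Rightarrow> 'b) \<Rightarrow> ('b \<Rightarrow> 'b) \<Rightarrow> nat" where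
  "hamming_dist A p s = card {x \<in> A. p x \<noteq> s x}"

text \<open>The symbols are \<open>0, \<dots>, n - 1\<close>. A permutation in the sense of \<^const>\<open>permutes\<close> is the
  identity outside its domain, so equality of functions is equality of permutations.\<close>

definition is_perm_array :: "nat \<Rightarrow> nat \<Rightarrow> (nat \<Rightarrow> nat) set \<Rightarrow> bool" where
  "is_perm_array n D S \<longleftrightarrow>
     (\<forall>p\<in>S. p permutes {..<n}) \<and>
     (\<forall>p\<in>S. \<forall>s\<in>S. p \<noteq> s \<longrightarrow> D \<le> hamming_dist {..<n} p s)"

text \<open>\<open>M(n,D)\<close>; there are finitely many such sets and the empty set is one of them, so the
  maximum is attained.\<close>

definition max_perm_array :: "nat \<Rightarrow> nat \<Rightarrow> nat" where
  "max_perm_array n D = Max {card S | S. is_perm_array n D S}"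

text \<open>The projective line over a field: \<^const>\<open>Some\<close> embeds the field, \<^const>\<open>None\<close> is the point
  at infinity.\<close>

type_synonym 'a proj_line = "'a option"

fun ratfun_eval :: "'a::field poly \<Rightarrow> 'a poly \<Rightarrow> 'a proj_line \<Rightarrow> 'a proj_line" where
  "ratfun_eval V U (Some a) = (if poly U a = 0 then None else Some (poly V a / poly U a))"
| "ratfun_eval V U None =
     (if degree V > degree U then None
      else if degree V < degree U then Some 0
      else Some (lead_coeff V / lead_coeff U))"

text \<open>\<open>P\<^bsub>v,u\<^esub>(q)\<close> as a set of elements of the field of fractions of the polynomial ring, so that
  proportional pairs \<open>(V, U)\<close> are identified.\<close>

definition PRF_set :: "nat \<Rightarrow> nat \<Rightarrow> 'a::field poly fract set" where
  "PRF_set v u = {Fract V U | V U.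
     V \<noteq> 0 \<and> U \<noteq> 0 \<and> coprime V U \<and> degree V = v \<and> degree U = u \<and> bij (ratfun_eval V U)}"

text \<open>The field \<open>\<F>\<^sub>q\<close> enters the counts as a type argument.\<close>

definition PRF_count :: "'a::{field,finite} itself \<Rightarrow> nat \<Rightarrow> nat \<Rightarrow> nat" where
  "PRF_count _ v u = card (PRF_set v u :: 'a poly fract set)"

text \<open>The degree bounds \<open>v \<le> (d+1)/2\<close> and \<open>u \<le> (d-3)/2\<close>, for odd \<open>d\<close>, are cleared of denominators
  and of the subtraction, which would be truncated at \<open>d = 1\<close>.\<close>

definition PRF_degrees :: "nat \<Rightarrow> (nat \<times> nat) set" where
  "PRF_degrees d = {(v, u).
     (v > u \<and> 2 * v \<le> d + 1) \<or> (v < u \<and> 2 * u + 3 \<le> d) \<or> (v = u \<and> 2 * v + 3 \<le> d)}"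

definition PRF_sum :: "'a::{field,finite} itself \<Rightarrow> nat \<Rightarrow> nat" where
  "PRF_sum T d = (\<Sum>(v, u)\<in>PRF_degrees d. PRF_count T v u)"

end

theory Submission
  imports "HOL-Algebra.Algebraic_Closure_Type" "HOL-Library.Cardinality" Defs
begin

text \<open>
  Lower bound: contracting a PRF at infinity changes it in at most one point, and not at all if it
  fixes infinity. Two distinct PRFs \<open>V/U\<close> and \<open>V'/U'\<close> agree only at roots of \<open>V U' - V' U\<close>, so
  the degree bounds in the definition of the sum leave at most five agreements.

  Counting: up to affine maps on the left, a PRF with numerator of degree 3 and denominator of degree
  2 is \<open>x + (r x + s)/U\<close> with \<open>U = x\<^sup>2 - t x + n\<close> irreducible. If \<open>z, z'\<close> are the roots of \<open>U\<close> and
  \<open>\<tau> = 1/(z' - z)\<close>, then \<open>1/(x - z) = \<tau> (1 - (x - z)\<^bsup>q-1\<^esup>)\<close> on \<open>\<F>\<^sub>q\<close>, which makes the power sums of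
  the partial fractions explicit. Vanishing of the first power sum, and of the second one (\<open>q\<close> odd) or
  third one (\<open>q\<close> even), of a permutation leaves a single pair \<open>(r, s) \<noteq> (0, 0)\<close>, and this pair gives
  a permutation. So every irreducible \<open>U\<close> contributes \<open>q (q - 1)\<close> PRFs. Cubic permutation
  polynomials are handled by Hermite's criterion.
\<close>

section \<open>Power sums over finite fields\<close>

text \<open>Multiplication by \<open>x \<noteq> 0\<close> permutes the nonzero elements, so their
  product absorbs the factor \<open>x ^ (q - 1)\<close>, where q stands for \<open>CARD('a)\<close>
  here and below.\<close>

lemma finite_field_power_card:
  fixes x :: "'a::{field,finite}"
  shows "x ^ CARD('a) = x"
proof (cases "x = 0")
  case False
  have "(\<Prod>y\<in>-{0}. x * y) = \<Prod>(-{0::'a})"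
    by (rule prod.reindex_bij_witness[of _ "\<lambda>y. y / x" "\<lambda>y. x * y"]) (use False in auto)
  hence "x ^ card (-{0::'a}) = 1"
    by (simp add: prod.distrib)
  moreover have "CARD('a) = Suc (card (-{0::'a}))"
    by (simp add: Compl_eq_Diff_UNIV card_Diff_singleton finite_UNIV_card_ge_0)
  ultimately show ?thesis
    by simp
qed (simp add: finite_UNIV_card_ge_0)

lemma of_nat_card_finite_field: "of_nat (CARD('a::{field,finite})) = (0 :: 'a)"
proof -
  have "(\<Sum>x\<in>UNIV. x + 1) = (\<Sum>x\<in>(UNIV :: 'a set). x)"
    by (rule sum.reindex_bij_witness[of _ "\<lambda>x. x - 1" "\<lambda>x. x + 1"]) auto
  thus ?thesis
    by (simp add: sum.distrib)
qed

lemma prime_CHAR_finite_field: "prime CHAR('a::{field,finite})"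
  by (simp add: prime_CHAR_semidom finite_imp_CHAR_pos)

lemma card_eq_CHAR_power:
  assumes "primepow (CARD('a::{field,finite}))"
  shows "\<exists>k>0. CARD('a) = CHAR('a) ^ k"
proof -
  obtain p k where pk: "prime p" "k > 0" "CARD('a) = p ^ k"
    using assms by (auto simp: primepow_def)
  have "CHAR('a) dvd p ^ k"
    using of_nat_card_finite_field[where ?'a = 'a] pk by (simp flip: of_nat_eq_0_iff_char_dvd)
  hence "CHAR('a) = p"
    using prime_dvd_power[OF prime_CHAR_finite_field] primes_dvd_imp_eq[OF prime_CHAR_finite_field pk(1)]
    by blast
  with pk show ?thesis by auto
qed

lemma CHAR_dvd_card_iff:
  assumes "primepow (CARD('a::{field,finite}))" "prime p"
  shows "p dvd CARD('a) \<longleftrightarrow> of_nat p = (0 :: 'a)"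
proof -
  obtain k where k: "k > 0" "CARD('a) = CHAR('a) ^ k"
    using card_eq_CHAR_power[OF assms(1)] by blast
  have prime: "prime CHAR('a)"
    by (rule prime_CHAR_finite_field)
  have "p dvd CARD('a) \<longleftrightarrow> p dvd CHAR('a)"
    unfolding k(2) using k(1) prime_dvd_power[OF assms(2)] dvd_power[of k "CHAR('a)"]
    by (meson dvd_trans)
  also have "\<dots> \<longleftrightarrow> CHAR('a) dvd p"
    using primes_dvd_imp_eq[OF assms(2) prime] primes_dvd_imp_eq[OF prime assms(2)] by auto
  finally show ?thesis
    by (simp add: of_nat_eq_0_iff_char_dvd)
qed

text \<open>Substituting \<open>a * x\<close> multiplies the sum by \<open>a ^ i\<close>. For
  \<open>0 < i < q - 1\<close> some nonzero \<open>a\<close> has \<open>a ^ i \<noteq> 1\<close>,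
  because \<open>x ^ i - 1\<close> cannot vanish at all q - 1 nonzero elements. For
  \<open>i = 0\<close> the sum is q, since \<open>0 ^ 0 = 1\<close>.\<close>

lemma sum_power_finite_field:
  assumes "i < CARD('a::{field,finite}) - 1"
  shows "(\<Sum>x\<in>UNIV. x ^ i) = (0 :: 'a)"
proof (cases "i = 0")
  case True
  thus ?thesis
    using of_nat_card_finite_field[where ?'a = 'a] by simp
next
  case False
  define p :: "'a poly" where "p = monom 1 i - 1"
  have deg: "degree p \<le> i"
    unfolding p_def by (intro degree_diff_le degree_monom_le) auto
  have "coeff p i = 1"
    using False by (simp add: p_def)
  hence "p \<noteq> 0" by auto
  have "\<exists>a :: 'a. a \<noteq> 0 \<and> a ^ i \<noteq> 1"
  proof (rule ccontr)
    assume "\<not> ?thesis"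
    hence "UNIV - {0} \<subseteq> {x. poly p x = 0}"
      by (auto simp: p_def poly_monom)
    hence "card (UNIV - {0::'a}) \<le> card {x. poly p x = 0}"
      by (intro card_mono) auto
    also have "\<dots> \<le> i"
      using card_poly_roots_bound[OF \<open>p \<noteq> 0\<close>] deg by linarith
    finally show False
      using assms by simp
  qed
  then obtain a :: 'a where a: "a \<noteq> 0" "a ^ i \<noteq> 1" by blast
  have "(\<Sum>x\<in>UNIV. x ^ i) = (\<Sum>x\<in>UNIV. (a * x) ^ i)"
    by (rule sum.reindex_bij_witness[of _ "\<lambda>x. a * x" "\<lambda>x. x / a"]) (use a in auto)
  also have "\<dots> = a ^ i * (\<Sum>x\<in>UNIV. x ^ i)"
    by (simp add: power_mult_distrib sum_distrib_left)
  finally have "(1 - a ^ i) * (\<Sum>x\<in>UNIV. x ^ i) = 0"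
    by (simp add: algebra_simps)
  with a show ?thesis by simp
qed

lemma sum_power_card_minus_1:
  assumes "CARD('a::{field,finite}) > 2"
  shows "(\<Sum>x\<in>UNIV. x ^ (CARD('a) - 1)) = (-1 :: 'a)"
proof -
  have "x ^ (CARD('a) - 1) = 1" if "x \<noteq> 0" for x :: 'a
    using finite_field_power_card[of x] that assms
    by (metis diff_Suc_1 less_nat_zero_code mult_cancel_left2 not0_implies_Suc power_Suc)
  note one = this
  have "(\<Sum>x\<in>UNIV - {0::'a}. x ^ (CARD('a) - 1)) = (\<Sum>x\<in>UNIV - {0::'a}. 1)"
    by (intro sum.cong refl) (simp add: one del: One_nat_def)
  also have "\<dots> = of_nat (CARD('a) - 1)"
    by simp
  also have "\<dots> = - (1 :: 'a)"
    using of_nat_card_finite_field[where ?'a = 'a] assms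
    by (simp add: of_nat_diff)
  finally show ?thesis
    using assms by (subst sum.remove[of _ 0]) auto
qed

text \<open>Only the monomial of degree \<open>m\<close> survives the summation. The map
  \<open>h\<close> lets one argument serve both the field itself and its image in the
  closure.\<close>

lemma sum_poly_eq_coeff:
  fixes p :: "'b::comm_ring_1 poly"
  assumes "\<And>i. i < m \<Longrightarrow> (\<Sum>x\<in>A. h x ^ i) = 0" "(\<Sum>x\<in>A. h x ^ m) = c" "degree p \<le> m"
  shows "(\<Sum>x\<in>A. poly p (h x)) = c * coeff p m"
proof -
  have "(\<Sum>x\<in>A. poly p (h x)) = (\<Sum>x\<in>A. \<Sum>i\<le>m. coeff p i * h x ^ i)"
    using assms(3) unfolding poly_altdef
    by (intro sum.cong refl sum.mono_neutral_left) (auto simp: coeff_eq_0)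
  also have "\<dots> = (\<Sum>i\<le>m. coeff p i * (\<Sum>x\<in>A. h x ^ i))"
    by (subst sum.swap) (simp add: sum_distrib_left)
  also have "\<dots> = (\<Sum>i\<in>{m}. coeff p i * (\<Sum>x\<in>A. h x ^ i))"
    by (rule sum.mono_neutral_right) (use assms(1) in auto)
  finally show ?thesis
    using assms(2) by (simp add: mult_ac)
qed

lemma sum_poly_finite_field:
  fixes p :: "'a::{field,finite} poly"
  assumes "degree p \<le> CARD('a) - 1" "CARD('a) > 2"
  shows "(\<Sum>x\<in>UNIV. poly p x) = - coeff p (CARD('a) - 1)"
  using sum_poly_eq_coeff[OF sum_power_finite_field sum_power_card_minus_1[OF assms(2)] assms(1)]
  by simp

lemma sum_poly_to_ac:
  fixes p :: "'a::{field,finite} alg_closure poly"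
  assumes "degree p \<le> CARD('a) - 1" "CARD('a) > 2"
  shows "(\<Sum>x\<in>UNIV. poly p (to_ac x)) = - coeff p (CARD('a) - 1)"
proof -
  have "(\<Sum>x\<in>UNIV. to_ac x ^ i) = (0 :: 'a alg_closure)" if "i < CARD('a) - 1" for i
    using sum_power_finite_field[OF that] by (simp flip: to_ac_power to_ac_sum)
  moreover have "(\<Sum>x\<in>UNIV. to_ac x ^ (CARD('a) - 1)) = (-1 :: 'a alg_closure)"
    using sum_power_card_minus_1[OF assms(2)]
    by (simp flip: to_ac_power to_ac_sum)
  ultimately show ?thesis
    using sum_poly_eq_coeff[of "CARD('a) - 1" to_ac UNIV "-1" p] assms by simp
qed

section \<open>Frobenius and the copy of the finite field in its closure\<close>

lemma frobenius_alg_closure: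
  fixes x y :: "'a::{field,finite} alg_closure"
  assumes "primepow (CARD('a))"
  shows "(x + y) ^ CARD('a) = x ^ CARD('a) + y ^ CARD('a)"
proof -
  have "prime CHAR('a alg_closure)"
    using prime_CHAR_finite_field[where ?'a = 'a] by simp
  thus ?thesis
    using card_eq_CHAR_power[OF assms] freshmans_dream'[of "CARD('a)" _ x y] by auto
qed

lemma frobenius_diff_alg_closure:
  fixes x y :: "'a::{field,finite} alg_closure"
  assumes "primepow (CARD('a))"
  shows "(x - y) ^ CARD('a) = x ^ CARD('a) - y ^ CARD('a)"
  using frobenius_alg_closure[OF assms, of "x - y" y] by (simp add: algebra_simps)

lemma to_ac_power_card: "to_ac x ^ CARD('a) = to_ac (x :: 'a::{field,finite})"
  using finite_field_power_card[of x] by (simp flip: to_ac_power)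

text \<open>The q elements of the field already exhaust the roots of X^q - X.\<close>

lemma power_card_eq_self_imp_range_to_ac:
  fixes z :: "'a::{field,finite} alg_closure"
  assumes "z ^ CARD('a) = z"
  shows "z \<in> range to_ac"
proof (rule ccontr)
  assume z: "z \<notin> range to_ac"
  define p :: "'a alg_closure poly" where "p = monom 1 (CARD('a)) - monom 1 1"
  have q: "CARD('a) > 1"
    using card_mono[of UNIV "{0, 1 :: 'a}"] by simp
  have "coeff p (CARD('a)) = 1"
    using q by (simp add: p_def)
  hence "p \<noteq> 0" by auto
  have "insert z (range to_ac) \<subseteq> {x. poly p x = 0}"
    using assms by (auto simp: p_def poly_monom to_ac_power_card)
  hence "card (insert z (range (to_ac :: 'a \<Rightarrow> _))) \<le> card {x. poly p x = 0}"
    by (intro card_mono poly_roots_finite \<open>p \<noteq> 0\<close>)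
  also have "\<dots> \<le> degree p"
    by (rule card_poly_roots_bound[OF \<open>p \<noteq> 0\<close>])
  also have "\<dots> \<le> CARD('a)"
    unfolding p_def using q by (intro degree_diff_le order.trans[OF degree_monom_le]) auto
  finally show False
    using z by (simp add: card_image inj_to_ac)
qed

section \<open>From permutation rational functions to permutation arrays\<close>

text \<open>Normal form for PRFs: scaling makes the denominator monic, after which the coprime pair
  is unique, so counting fractions becomes counting pairs of polynomials.\<close>

definition monic_PRF_pairs :: "nat \<Rightarrow> nat \<Rightarrow> ('a::field poly \<times> 'a poly) set" where
  "monic_PRF_pairs v u = {(V, U). V \<noteq> 0 \<and> lead_coeff U = 1 \<and> coprime V U \<and>
     degree V = v \<and> degree U = u \<and> bij (ratfun_eval V U)}"

section \<open>Uniqueness of reduced fractions with monic denominator\<close>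

lemma lead_coeff_1_imp_nonzero: "lead_coeff p = (1 :: 'a::zero_neq_one) \<Longrightarrow> p \<noteq> 0"
  by auto

text \<open>The type class \<^class>\<open>field\<close> provides no gcd on polynomials, so the library's Euclid lemma does
  not apply.\<close>

lemma coprime_poly_bezout:
  fixes p q :: "'a::field poly"
  assumes "coprime p q"
  shows "\<exists>a b. a * p + b * q = 1"
proof -
  define I where "I = {a * p + b * q | a b. True}"
  have I: "a * p + b * q \<in> I" for a b
    by (auto simp: I_def)
  have "p \<noteq> 0 \<or> q \<noteq> 0"
    using assms by auto
  hence "\<exists>d. d \<in> I \<and> d \<noteq> 0"
    using I[of 1 0] I[of 0 1] by auto
  then obtain d where d: "d \<in> I" "d \<noteq> 0" and min: "\<And>d'. d' \<in> I \<Longrightarrow> d' \<noteq> 0 \<Longrightarrow> degree d \<le> degree d'"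
    using ex_has_least_nat[of "\<lambda>d. d \<in> I \<and> d \<noteq> 0" _ degree] by blast
  obtain a b where ab: "d = a * p + b * q"
    using d(1) by (auto simp: I_def)
  have dvd: "d dvd c" if "c \<in> I" for c
  proof -
    obtain a' b' where c: "c = a' * p + b' * q"
      using \<open>c \<in> I\<close> by (auto simp: I_def)
    have "c mod d = (a' - c div d * a) * p + (b' - c div d * b) * q"
      unfolding minus_div_mult_eq_mod[symmetric] by (simp add: c ab algebra_simps)
    hence "c mod d \<in> I"
      using I by simp
    hence "c mod d = 0"
      using min[of "c mod d"] degree_mod_less'[OF d(2), of c] by linarith
    thus ?thesis by auto
  qed
  have "is_unit d"
    using coprime_common_divisor[OF assms] dvd[OF I[of 1 0]] dvd[OF I[of 0 1]] by simp
  then obtain e where e: "1 = d * e" by (auto elim: dvdE)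
  have "(e * a) * p + (e * b) * q = 1"
    unfolding e by (simp add: ab algebra_simps)
  thus ?thesis by blast
qed

lemma coprime_poly_dvd_mult:
  fixes p q r :: "'a::field poly"
  assumes "coprime p q" "p dvd q * r"
  shows "p dvd r"
proof -
  obtain a b where ab: "a * p + b * q = 1"
    using coprime_poly_bezout[OF assms(1)] by blast
  have "r = (a * r) * p + b * (q * r)"
    using arg_cong[OF ab, of "\<lambda>x. x * r"] by (simp add: algebra_simps)
  moreover have "p dvd (a * r) * p + b * (q * r)"
    using assms(2) by simp
  ultimately show ?thesis by simp
qed

lemma monic_dvd_antisym:
  fixes p q :: "'a::field poly"
  assumes "p dvd q" "q dvd p" "lead_coeff p = 1" "lead_coeff q = 1"
  shows "p = q"
proof -
  obtain k where k: "q = p * k"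
    using assms(1) by (auto elim: dvdE)
  have nz: "p \<noteq> 0" "q \<noteq> 0"
    using assms(3,4) by auto
  have "degree q \<le> degree p"
    by (rule dvd_imp_degree_le[OF assms(2) nz(1)])
  hence "degree k = 0"
    using nz k by (simp add: degree_mult_eq)
  moreover have "lead_coeff k = 1"
    using assms(3,4) k by (simp add: lead_coeff_mult)
  ultimately show ?thesis
    using k by (auto elim!: degree_eq_zeroE)
qed

text \<open>Coprimality makes each denominator divide the other, and monic associates are equal.
  Besides uniqueness this shows that \<open>V * U' - V' * U\<close> is nonzero for distinct PRFs, so
  that its roots can be counted.\<close>

lemma coprime_cross_mult_eq_imp_eq:
  fixes V U V' U' :: "'a::field poly"
  assumes "coprime V U" "coprime V' U'" "lead_coeff U = 1" "lead_coeff U' = 1" "V * U' = V' * U"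
  shows "V = V' \<and> U = U'"
proof -
  have "U dvd V * U'" "U' dvd V' * U"
    using dvd_triv_right[of U V'] dvd_triv_right[of U' V] assms(5) by simp_all
  hence "U dvd U'" "U' dvd U"
    using assms(1,2) by (auto intro: coprime_poly_dvd_mult simp: coprime_commute)
  hence "U = U'"
    using assms(3,4) by (rule monic_dvd_antisym)
  thus ?thesis
    using assms(3,5) by auto
qed

lemma coprime_smult:
  fixes V U :: "'a::field poly"
  assumes "c \<noteq> 0" "coprime V U"
  shows "coprime (smult c V) (smult c U)"
proof (rule coprimeI)
  fix d assume "d dvd smult c V" "d dvd smult c U"
  hence "d dvd V" "d dvd U"
    using assms(1) by (auto dest: dvd_smult_cancel)
  thus "is_unit d"
    using assms(2) coprime_common_divisor by blast
qed

lemma ratfun_eval_smult: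
  fixes V U :: "'a::field poly"
  assumes "c \<noteq> 0"
  shows "ratfun_eval (smult c V) (smult c U) = ratfun_eval V U"
proof
  fix x show "ratfun_eval (smult c V) (smult c U) x = ratfun_eval V U x"
    using assms by (cases x) auto
qed

lemma bij_betw_Fract_monic_PRF_pairs:
  "bij_betw (\<lambda>(V, U). Fract V U) (monic_PRF_pairs v u) (PRF_set v u)"
proof (rule bij_betwI')
  fix p p' :: "'a poly \<times> 'a poly"
  assume "p \<in> monic_PRF_pairs v u" "p' \<in> monic_PRF_pairs v u"
  thus "((case p of (V, U) \<Rightarrow> Fract V U) = (case p' of (V, U) \<Rightarrow> Fract V U)) \<longleftrightarrow> p = p'"
    using coprime_cross_mult_eq_imp_eq[of "fst p" "snd p" "fst p'" "snd p'"]
    by (cases p, cases p')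
      (auto simp: monic_PRF_pairs_def Fraction_Field.eq_fract(1)[OF lead_coeff_1_imp_nonzero lead_coeff_1_imp_nonzero])
next
  fix p :: "'a poly \<times> 'a poly"
  assume "p \<in> monic_PRF_pairs v u"
  thus "(case p of (V, U) \<Rightarrow> Fract V U) \<in> PRF_set v u"
    by (cases p) (force simp: monic_PRF_pairs_def PRF_set_def)
next
  fix f :: "'a poly fract"
  assume "f \<in> PRF_set v u"
  then obtain V U where VU: "f = Fract V U" "V \<noteq> 0" "U \<noteq> 0" "coprime V U" "degree V = v"
    "degree U = u" "bij (ratfun_eval V U)"
    by (auto simp: PRF_set_def)
  define c where "c = inverse (lead_coeff U)"
  have lead: "coeff U u \<noteq> 0"
    using VU(3,6) leading_coeff_neq_0 by metis
  hence c: "c \<noteq> 0" "c * coeff U u = 1"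
    using VU(6) by (simp_all add: c_def)
  have "(smult c V, smult c U) \<in> monic_PRF_pairs v u"
    using VU c lead coprime_smult[OF c(1) VU(4)]
    by (auto simp: monic_PRF_pairs_def ratfun_eval_smult)
  moreover have "f = Fract (smult c V) (smult c U)"
    using VU c(1) by (simp add: Fraction_Field.eq_fract)
  ultimately show "\<exists>p\<in>monic_PRF_pairs v u. f = (case p of (V, U) \<Rightarrow> Fract V U)"
    by force
qed

lemma PRF_count_eq:
  "PRF_count TYPE('a::{field,finite}) v u = card (monic_PRF_pairs v u :: ('a poly \<times> 'a poly) set)"
  unfolding PRF_count_def using bij_betw_same_card[OF bij_betw_Fract_monic_PRF_pairs] by metis

section \<open>The degree pairs for d = 5\<close>

lemma PRF_degrees_5:
  "PRF_degrees 5 = {(0,0), (1,1), (0,1), (1,0), (2,0), (3,0), (2,1), (3,1), (3,2)}"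
proof (intro Set.set_eqI iffI)
  fix p assume "p \<in> PRF_degrees 5"
  then obtain v u where p: "p = (v, u)" and vu: "v \<le> 3" "u \<le> 2"
    and "(v > u \<and> 2 * v \<le> 6) \<or> (v < u \<and> 2 * u + 3 \<le> 5) \<or> (v = u \<and> 2 * v + 3 \<le> 5)"
    by (auto simp: PRF_degrees_def)
  moreover have "v = 0 \<or> v = 1 \<or> v = 2 \<or> v = 3" "u = 0 \<or> u = 1 \<or> u = 2"
    using vu by auto
  ultimately show "p \<in> {(0,0), (1,1), (0,1), (1,0), (2,0), (3,0), (2,1), (3,1), (3,2)}"
    by auto
qed (auto simp: PRF_degrees_def)

lemma finite_poly_degree_le: "finite {p :: 'a::{finite,zero} poly. degree p \<le> n}"
proof -
  have "{p :: 'a poly. degree p \<le> n} \<subseteq> Poly ` {xs. set xs \<subseteq> UNIV \<and> length xs \<le> Suc n}"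
  proof
    fix p :: "'a poly"
    assume "p \<in> {p. degree p \<le> n}"
    moreover have "length (coeffs p) \<le> Suc (degree p)"
      by (simp add: length_coeffs_degree le_Suc_eq coeffs_def)
    ultimately show "p \<in> Poly ` {xs. set xs \<subseteq> UNIV \<and> length xs \<le> Suc n}"
      by (intro image_eqI[of _ _ "coeffs p"]) auto
  qed
  thus ?thesis
    by (rule finite_subset) (intro finite_imageI finite_lists_length_le finite)
qed

lemma finite_monic_PRF_pairs:
  "finite (monic_PRF_pairs v u :: ('a::{field,finite} poly \<times> 'a poly) set)"
  by (rule finite_subset[OF _ finite_cartesian_product[OF finite_poly_degree_le[of v]
        finite_poly_degree_le[of u]]]) (auto simp: monic_PRF_pairs_def)

text \<open>The degrees can be read off a pair, so the families are disjoint and the sum is the size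
  of a single set, which can be mapped into permutations.\<close>

lemma PRF_sum_5:
  "PRF_sum TYPE('a::{field,finite}) 5 =
     card (\<Union>(v, u)\<in>PRF_degrees 5. monic_PRF_pairs v u :: ('a poly \<times> 'a poly) set)"
proof -
  define M where "M = (\<lambda>(v, u). monic_PRF_pairs v u :: ('a poly \<times> 'a poly) set)"
  have "card (\<Union>p\<in>PRF_degrees 5. M p) = (\<Sum>p\<in>PRF_degrees 5. card (M p))"
  proof (rule card_UN_disjoint)
    show "finite (PRF_degrees 5)"
      by (simp add: PRF_degrees_5)
  qed (auto simp: M_def finite_monic_PRF_pairs, auto simp: monic_PRF_pairs_def)
  thus ?thesis
    unfolding PRF_sum_def PRF_count_eq M_def by (simp add: case_prod_beta)
qed

text \<open>The contraction of a permutation of the projective line removes the point at infinity from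
  its cycle.\<close>

definition contraction :: "('a option \<Rightarrow> 'a option) \<Rightarrow> 'a \<Rightarrow> 'a" where
  "contraction f x = (case f (Some x) of Some y \<Rightarrow> y | None \<Rightarrow> the (f None))"

text \<open>If \<open>f (Some x) = None\<close>, injectivity rules out \<open>f None = None\<close>,
  so \<open>the\<close> gets a proper argument. The value \<open>f None\<close> is not taken at any
  \<open>Some y\<close>, so the repair creates no collision.\<close>

lemma bij_contraction:
  fixes f :: "'a::finite option \<Rightarrow> 'a option"
  assumes "bij f"
  shows "bij (contraction f)"
proof -
  have inj: "f x = f y \<longleftrightarrow> x = y" for x y
    using assms by (auto simp: bij_def inj_def)
  have "inj (contraction f)"
  proof (rule injI)
    fix x y assume "contraction f x = contraction f y"
    thus "x = y"
      using inj[of "Some x" "Some y"] inj[of "Some x" None] inj[of "Some y" None]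
      by (auto simp: contraction_def split: option.splits)
  qed
  thus ?thesis
    by (simp add: bij_def finite_UNIV_inj_surj)
qed

text \<open>Where neither function has a pole, an agreement is a root of
  \<open>V * U' - V' * U\<close>. Contraction alters a function only at a finite pole: there is none
  if infinity is fixed, and by injectivity at most one otherwise. The sets \<open>N\<close> collect
  these poles.\<close>

lemma card_contraction_agree_le:
  fixes V U V' U' :: "'a::{field,finite} poly"
  assumes inj: "inj (ratfun_eval V U)" "inj (ratfun_eval V' U')"
    and neq: "V * U' \<noteq> V' * U"
  shows "card {x. contraction (ratfun_eval V U) x = contraction (ratfun_eval V' U') x} \<le>
     degree (V * U' - V' * U) + of_bool (degree V \<le> degree U) + of_bool (degree V' \<le> degree U')"
proof -
  define N where "N V U = {x :: 'a. degree V \<le> degree U \<and> poly U x = 0}" for V U :: "'a poly"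
  have N: "card (N V U) \<le> of_bool (degree V \<le> degree U)"
    if "inj (ratfun_eval V U)" for V U :: "'a poly"
  proof (cases "degree V \<le> degree U")
    case True
    have "x = y" if "x \<in> N V U" "y \<in> N V U" for x y
      using \<open>inj (ratfun_eval V U)\<close>[THEN injD, of "Some x" "Some y"] that by (auto simp: N_def)
    hence "card (N V U) \<le> Suc 0"
      by (subst card_le_Suc0_iff_eq) auto
    thus ?thesis using True by simp
  qed (auto simp: N_def)
  have no_root: "poly U x \<noteq> 0" if "inj (ratfun_eval V U)" "degree V > degree U" for V U :: "'a poly" and x
    using that(1)[THEN injD, of "Some x" None] that(2) by auto
  have *: "{x. contraction (ratfun_eval V U) x = contraction (ratfun_eval V' U') x} \<subseteq>
    {x. poly (V * U' - V' * U) x = 0} \<union> N V U \<union> N V' U'"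
    using no_root[OF inj(1)] no_root[OF inj(2)]
    by (auto simp: contraction_def N_def field_simps not_le split: if_splits)
  have "card {x. contraction (ratfun_eval V U) x = contraction (ratfun_eval V' U') x} \<le>
    card ({x. poly (V * U' - V' * U) x = 0} \<union> N V U \<union> N V' U')"
    by (rule card_mono[OF _ *]) auto
  also have "\<dots> \<le> card {x. poly (V * U' - V' * U) x = 0} + card (N V U) + card (N V' U')"
    by (meson card_Un_le add_mono order.refl order.trans)
  also have "\<dots> \<le> degree (V * U' - V' * U) + of_bool (degree V \<le> degree U) + of_bool (degree V' \<le> degree U')"
    by (intro add_mono N inj card_poly_roots_bound) (use neq in auto)
  finally show ?thesis .
qed

text \<open>If both functions fix infinity, the degree of the difference is at most 3 + 2. A pair
  with \<open>v \<le> u\<close> has both entries at most 1: one such pair leaves degree at most 4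
  plus one altered point, two of them leave degree at most 2 plus two altered points.\<close>

lemma card_contraction_agree_le_5:
  fixes V U V' U' :: "'a::{field,finite} poly"
  assumes "(V, U) \<in> monic_PRF_pairs v u" "(v, u) \<in> PRF_degrees 5"
    and "(V', U') \<in> monic_PRF_pairs v' u'" "(v', u') \<in> PRF_degrees 5"
    and "(V, U) \<noteq> (V', U')"
  shows "card {x. contraction (ratfun_eval V U) x = contraction (ratfun_eval V' U') x} \<le> 5"
proof -
  have deg: "degree V = v" "degree U = u" "degree V' = v'" "degree U' = u'"
    using assms by (auto simp: monic_PRF_pairs_def)
  have neq: "V * U' \<noteq> V' * U"
    using assms coprime_cross_mult_eq_imp_eq[of V U V' U'] by (auto simp: monic_PRF_pairs_def)
  have "card {x. contraction (ratfun_eval V U) x = contraction (ratfun_eval V' U') x} \<le>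
     degree (V * U' - V' * U) + of_bool (v \<le> u) + of_bool (v' \<le> u')"
    using card_contraction_agree_le[OF _ _ neq] assms deg by (auto simp: monic_PRF_pairs_def bij_def)
  also have "degree (V * U' - V' * U) \<le> max (v + u') (v' + u)"
    using deg degree_mult_le[of V U'] degree_mult_le[of V' U] by (intro degree_diff_le) auto
  also have "max (v + u') (v' + u) + of_bool (v \<le> u) + of_bool (v' \<le> u') \<le> 5"
    using assms(2,4) unfolding PRF_degrees_5 by auto
  finally show ?thesis by simp
qed

section \<open>From bijections of a finite set to permutation arrays\<close>

lemma finite_perm_arrays: "finite {card S | S. is_perm_array n D S}"
proof (rule finite_subset)
  show "{card S | S. is_perm_array n D S} \<subseteq> card ` Pow {p. p permutes {..<n}}"
    by (auto simp: is_perm_array_def)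
qed (simp add: finite_permutations)

text \<open>Conjugation by a bijection \<open>h\<close> onto \<open>{..<CARD('a)}\<close> preserves
  the number of agreements; extension by the identity yields \<open>permutes\<close>.\<close>

lemma card_le_max_perm_array:
  fixes F :: "('a::finite \<Rightarrow> 'a) set"
  assumes bij: "\<And>f. f \<in> F \<Longrightarrow> bij f"
    and agree: "\<And>f g. f \<in> F \<Longrightarrow> g \<in> F \<Longrightarrow> f \<noteq> g \<Longrightarrow> card {x. f x = g x} \<le> k"
  shows "card F \<le> max_perm_array (CARD('a)) (CARD('a) - k)"
proof -
  obtain h :: "'a \<Rightarrow> nat" where h: "bij_betw h UNIV {..<CARD('a)}"
    using ex_bij_betw_finite_nat[of "UNIV :: 'a set"] by (auto simp: atLeast0LessThan)
  define g where "g = inv_into UNIV h"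
  have g: "g (h x) = x" for x
    using h by (simp add: g_def bij_betw_inv_into_left)
  have hg: "h (g i) = i" if "i < CARD('a)" for i
    using h that by (simp add: g_def bij_betw_inv_into_right)
  have hlt: "h x < CARD('a)" for x
    using h by (auto simp: bij_betw_def)
  define T where "T f = (\<lambda>i. if i < CARD('a) then h (f (g i)) else i)" for f :: "'a \<Rightarrow> 'a"
  have T_h: "T f (h x) = h (f x)" for f x
    by (simp add: T_def hlt g)
  have hinj: "h x = h y \<longleftrightarrow> x = y" for x y
    using g by metis
  have inj: "inj T"
    by (rule injI) (metis T_h hinj ext)
  have perm: "T f permutes {..<CARD('a)}" if "bij f" for f
  proof (rule bij_imp_permutes)
    have "bij_betw ((h \<circ> f) \<circ> g) {..<CARD('a)} {..<CARD('a)}"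
      unfolding g_def
      by (rule bij_betw_trans[OF bij_betw_inv_into[OF h] bij_betw_trans[OF that h]])
    thus "bij_betw (T f) {..<CARD('a)} {..<CARD('a)}"
      by (rule bij_betw_cong[THEN iffD1, rotated]) (simp add: T_def)
  qed (simp add: T_def)
  have "CARD('a) - k \<le> hamming_dist {..<CARD('a)} (T f) (T f')"
    if "f \<in> F" "f' \<in> F" "f \<noteq> f'" for f f'
  proof -
    have "{i \<in> {..<CARD('a)}. T f i \<noteq> T f' i} = h ` {x. f x \<noteq> f' x}"
    proof (intro subset_antisym subsetI)
      fix i assume "i \<in> {i \<in> {..<CARD('a)}. T f i \<noteq> T f' i}"
      thus "i \<in> h ` {x. f x \<noteq> f' x}"
        by (intro image_eqI[of _ _ "g i"]) (auto simp: hg T_def hinj)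
    next
      fix i assume "i \<in> h ` {x. f x \<noteq> f' x}"
      thus "i \<in> {i \<in> {..<CARD('a)}. T f i \<noteq> T f' i}"
        using hlt by (auto simp: T_h hinj)
    qed
    hence "hamming_dist {..<CARD('a)} (T f) (T f') = card {x. f x \<noteq> f' x}"
      by (simp add: hamming_dist_def card_image inj_on_def hinj)
    also have "{x. f x \<noteq> f' x} = UNIV - {x. f x = f' x}" by auto
    also have "card \<dots> = CARD('a) - card {x. f x = f' x}"
      by (simp add: card_Diff_subset)
    finally show ?thesis
      using agree[OF that] by simp
  qed
  hence "is_perm_array (CARD('a)) (CARD('a) - k) (T ` F)"
    using perm bij by (auto simp: is_perm_array_def)
  hence "card (T ` F) \<le> max_perm_array (CARD('a)) (CARD('a) - k)"
    unfolding max_perm_array_def by (intro Max_ge finite_perm_arrays) blast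
  thus ?thesis
    using inj by (simp add: card_image inj_on_subset)
qed

lemma PRF_sum_le_max_perm_array:
  assumes "CARD('a::{field,finite}) > 5"
  shows "PRF_sum TYPE('a) 5 \<le> max_perm_array (CARD('a)) (CARD('a) - 5)"
proof -
  define P where "P = (\<Union>(v, u)\<in>PRF_degrees 5. monic_PRF_pairs v u :: ('a poly \<times> 'a poly) set)"
  define C where "C = (\<lambda>(V, U :: 'a poly). contraction (ratfun_eval V U))"
  have agree: "card {x. C p x = C p' x} \<le> 5" if "p \<in> P" "p' \<in> P" "p \<noteq> p'" for p p'
    using that unfolding P_def C_def by (cases p, cases p') (auto intro!: card_contraction_agree_le_5)
  \<comment> \<open>Equal contractions of distinct PRFs would agree at all q > 5 points.\<close>
  have "inj_on C P"
  proof (rule inj_onI, rule ccontr)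
    fix p p' assume "p \<in> P" "p' \<in> P" "C p = C p'" "p \<noteq> p'"
    with agree[of p p'] assms show False by simp
  qed
  hence "card P = card (C ` P)"
    by (simp add: card_image)
  also have "\<dots> \<le> max_perm_array (CARD('a)) (CARD('a) - 5)"
  proof (rule card_le_max_perm_array)
    show "bij f" if "f \<in> C ` P" for f
      using that by (auto simp: C_def P_def monic_PRF_pairs_def intro!: bij_contraction)
    show "card {x. f x = g x} \<le> 5" if "f \<in> C ` P" "g \<in> C ` P" "f \<noteq> g" for f g
      using that agree by blast
  qed
  finally show ?thesis
    unfolding PRF_sum_5 P_def .
qed

section \<open>Partial fractions in the algebraic closure\<close>

text \<open>For x in the field, \<open>y = to_ac x - z\<close> satisfies
  \<open>y ^ q = y - w\<close> with \<open>w = z ^ q - z\<close>. Division by a power of y expresses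
  \<open>1 / y ^ (i + 1)\<close> through \<open>1 / y ^ i\<close> and a power of y with exponent q -
  1 - i, and the sums follow by induction on i.\<close>

lemma sum_inverse_power_to_ac:
  fixes z :: "'a::{field,finite} alg_closure"
  assumes "primepow (CARD('a))" "CARD('a) > 2"
    and z: "z ^ CARD('a) \<noteq> z"
    and j: "0 < j" "j < CARD('a)"
  shows "(\<Sum>x\<in>UNIV. (1 / (to_ac x - z)) ^ j) = (1 / (z ^ CARD('a) - z)) ^ j"
proof -
  define w where "w = z ^ CARD('a) - z"
  have w: "w \<noteq> 0"
    using z by (simp add: w_def)
  have nz: "to_ac x - z \<noteq> 0" for x
    using z to_ac_power_card[of x] by auto
  have step: "(1 / (to_ac x - z)) ^ Suc i =
      1 / w * ((1 / (to_ac x - z)) ^ i - poly ([:-z, 1:] ^ (CARD('a) - 1 - i)) (to_ac x))"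
    if i: "i < CARD('a)" for i x
  proof -
    define y where "y = to_ac x - z"
    have "y ^ CARD('a) = y - w"
      unfolding y_def w_def frobenius_diff_alg_closure[OF assms(1)] by (simp add: to_ac_power_card)
    hence "y ^ (CARD('a) - 1 - i) * y ^ Suc i = y - w"
      using i by (simp add: power_add[symmetric] del: power_Suc)
    thus ?thesis
      using w nz[of x] by (simp add: poly_power field_simps flip: y_def)
  qed
  have sum: "(\<Sum>x\<in>UNIV. poly ([:-z, 1:] ^ i) (to_ac x)) = (if i = CARD('a) - 1 then -1 else 0)"
    if "i \<le> CARD('a) - 1" for i
    using sum_poly_to_ac[of "[:-z, 1:] ^ i"] that assms(2)
    by (auto simp: degree_linear_power coeff_eq_0 coeff_linear_power)
  have "(\<Sum>x\<in>UNIV. (1 / (to_ac x - z)) ^ Suc i) = (1 / w) ^ Suc i" if "Suc i < CARD('a)" for i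
    using that
  proof (induction i)
    \<comment> \<open>Only here does the polynomial reach degree q - 1 and contribute -1; the sum of
      q ones vanishes, which leaves \<open>1 / w\<close>. Each later step merely adds another factor
      \<open>1 / w\<close>.\<close>
    case 0
    have "(\<Sum>x\<in>UNIV. (1 / (to_ac x - z)) ^ Suc 0) =
        1 / w * ((\<Sum>x\<in>(UNIV :: 'a set). 1) - (\<Sum>x\<in>UNIV. poly ([:-z, 1:] ^ (CARD('a) - 1)) (to_ac x)))"
      using 0 by (subst step) (simp_all add: sum_distrib_left sum_subtractf diff_divide_distrib sum_divide_distrib)
    also have "(\<Sum>x\<in>(UNIV :: 'a set). 1) = (0 :: 'a alg_closure)"
      using arg_cong[OF of_nat_card_finite_field[where ?'a = 'a], of to_ac] by simp
    finally show ?case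
      using sum[of "CARD('a) - 1"] by simp
  next
    case (Suc i)
    have "(\<Sum>x\<in>UNIV. (1 / (to_ac x - z)) ^ Suc (Suc i)) =
        1 / w * ((\<Sum>x\<in>UNIV. (1 / (to_ac x - z)) ^ Suc i) -
          (\<Sum>x\<in>UNIV. poly ([:-z, 1:] ^ (CARD('a) - 1 - Suc i)) (to_ac x)))"
      using Suc.prems
      by (subst step) (simp_all add: sum_distrib_left sum_subtractf diff_divide_distrib sum_divide_distrib)
    also have "(\<Sum>x\<in>UNIV. poly ([:-z, 1:] ^ (CARD('a) - 1 - Suc i)) (to_ac x)) = 0"
      using Suc.prems by (subst sum) auto
    finally show ?case
      using Suc by simp
  qed
  from this[of "j - 1"] show ?thesis
    using j by (simp add: w_def)
qed

text \<open>A root z in the closure lies outside the field, so Frobenius, which fixes the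
  coefficients, moves it to a second root. Subtracting the two root equations and cancelling
  \<open>z - z'\<close> gives the trace.\<close>

lemma conjugate_root_alg_closure:
  fixes t n :: "'a::{field,finite}"
  assumes "primepow (CARD('a))" and no_root: "\<And>x. x\<^sup>2 - t * x + n \<noteq> 0"
  obtains z z' where "z \<noteq> z'" "z ^ CARD('a) = z'" "z' ^ CARD('a) = z"
    "z + z' = to_ac t" "z * z' = to_ac n"
proof -
  obtain z where "poly [:to_ac n, - to_ac t, 1:] z = 0"
    using alg_closed_imp_poly_has_root[of "[:to_ac n, - to_ac t, 1:]"] by auto
  hence z: "z\<^sup>2 - to_ac t * z + to_ac n = 0"
    by (simp add: algebra_simps power2_eq_square)
  define z' where "z' = z ^ CARD('a)"
  have "z \<notin> range to_ac"
  proof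
    assume "z \<in> range to_ac"
    then obtain x where "z = to_ac x" by auto
    with z have "to_ac (x\<^sup>2 - t * x + n) = 0" by simp
    with no_root[of x] show False
      unfolding to_ac_eq_0_iff by contradiction
  qed
  hence neq: "z \<noteq> z'"
    using power_card_eq_self_imp_range_to_ac[of z] by (auto simp: z'_def)
  have "(z\<^sup>2) ^ CARD('a) = z'\<^sup>2"
    unfolding z'_def by (metis mult.commute power_mult)
  hence "(z\<^sup>2 - to_ac t * z + to_ac n) ^ CARD('a) = z'\<^sup>2 - to_ac t * z' + to_ac n"
    by (simp only: frobenius_alg_closure[OF assms(1)] frobenius_diff_alg_closure[OF assms(1)]
        power_mult_distrib to_ac_power_card z'_def)
  hence z': "z'\<^sup>2 - to_ac t * z' + to_ac n = 0"
    using z by (simp add: power_0_left)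
  have "(z - z') * (z + z' - to_ac t) = 0"
    using z z' by Groebner_Basis.algebra
  hence sum: "z + z' = to_ac t"
    using neq by simp
  have prod: "z * z' = to_ac n"
    using z unfolding sum[symmetric] by Groebner_Basis.algebra
  have "z' ^ CARD('a) = (to_ac t - z) ^ CARD('a)"
    by (simp flip: sum)
  also have "\<dots> = z"
    unfolding frobenius_diff_alg_closure[OF assms(1)] to_ac_power_card
    by (simp flip: z'_def sum)
  finally show ?thesis
    by (rule that[OF neq z'_def[symmetric] _ sum prod])
qed

text \<open>Let z, z' be the roots of the denominator in a splitting field and
  \<open>\<alpha> = 4 * n - t\<^sup>2\<close>. The function is
  \<open>x + \<alpha> * (1 / (x - z) + 1 / (x - z'))\<close>, and clearing denominators in an
  equality of two values leaves \<open>x - y\<close> times a norm that cannot vanish.\<close>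

lemma cubic_over_quadratic_inj:
  fixes t n :: "'a::field"
  assumes no_root: "\<And>x. x\<^sup>2 - t * x + n \<noteq> 0"
  shows "inj (\<lambda>x. x + (2 * (4 * n - t\<^sup>2) * x - (4 * n - t\<^sup>2) * t) / (x\<^sup>2 - t * x + n))"
proof (rule injI, rule ccontr)
  fix x y :: 'a
  define \<alpha> where "\<alpha> = 4 * n - t\<^sup>2"
  define U where "U = (\<lambda>x. x\<^sup>2 - t * x + n)"
  \<comment> \<open>Chosen so that \<open>A + z * (x - y) = (x - z) * (y - z') - \<alpha>\<close>;
    the cofactor below is the product of this element and its conjugate.\<close>
  define A where "A = x * y - t * x + t\<^sup>2 - 3 * n"
  assume "x + (2 * (4 * n - t\<^sup>2) * x - (4 * n - t\<^sup>2) * t) / (x\<^sup>2 - t * x + n) =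
      y + (2 * (4 * n - t\<^sup>2) * y - (4 * n - t\<^sup>2) * t) / (y\<^sup>2 - t * y + n)"
    and neq: "x \<noteq> y"
  hence "x + (2 * \<alpha> * x - \<alpha> * t) / U x = y + (2 * \<alpha> * y - \<alpha> * t) / U y"
    by (simp add: \<alpha>_def U_def)
  moreover have nz: "U z \<noteq> 0" for z
    using no_root by (simp add: U_def)
  ultimately have "(x - y) * (U x * U y) + (2 * \<alpha> * x - \<alpha> * t) * U y - (2 * \<alpha> * y - \<alpha> * t) * U x = 0"
    using nz[of x] nz[of y] by (simp add: field_simps)
  \<comment> \<open>The cofactor of \<open>x - y\<close> is the homogenization of \<open>U\<close> at \<open>(-A, x - y)\<close>, hence anisotropic.\<close>
  moreover have "(x - y) * (U x * U y) + (2 * \<alpha> * x - \<alpha> * t) * U y - (2 * \<alpha> * y - \<alpha> * t) * U x =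
      (x - y) * (A\<^sup>2 + t * A * (x - y) + n * (x - y)\<^sup>2)"
    unfolding U_def A_def \<alpha>_def by (simp add: algebra_simps power2_eq_square)
  ultimately have "A\<^sup>2 + t * A * (x - y) + n * (x - y)\<^sup>2 = 0"
    using neq by simp
  moreover have "A\<^sup>2 + t * A * d + n * d\<^sup>2 = d\<^sup>2 * U (- A / d)" if "d \<noteq> 0" for d
    using that unfolding U_def by (simp add: field_simps power2_eq_square)
  ultimately show False
    using nz[of "- A / (x - y)"] neq by simp
qed

text \<open>The part of Hermite's criterion used here: a permutation has the same power sums as the
  field itself.\<close>

lemma sum_power_inj_eq_0:
  fixes f :: "'a::{field,finite} \<Rightarrow> 'a"
  assumes "inj f" "k < CARD('a) - 1"
  shows "(\<Sum>x\<in>UNIV. f x ^ k) = 0"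
proof -
  have "(\<Sum>x\<in>UNIV. f x ^ k) = (\<Sum>x\<in>range f. x ^ k)"
    using assms(1) by (simp add: sum.reindex)
  also have "range f = UNIV"
    using finite_UNIV_inj_surj[OF _ assms(1)] by auto
  finally show ?thesis
    using sum_power_finite_field[OF assms(2)] by simp
qed

lemma sum_power_to_ac_inj_eq_0:
  fixes f :: "'a::{field,finite} \<Rightarrow> 'a"
  assumes "inj f" "k < CARD('a) - 1"
  shows "(\<Sum>x\<in>UNIV. to_ac (f x) ^ k) = 0"
  using sum_power_inj_eq_0[OF assms] by (simp flip: to_ac_power to_ac_sum)

text \<open>The first power sum makes the residues at the two conjugate poles equal, and the next
  informative one fixes their common value. Exponents up to 3 are available because
  \<open>CARD('a) > 4\<close> gives 3 < q - 1.\<close>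

lemma inj_imp_cubic_over_quadratic:
  fixes r s t n :: "'a::{field,finite}"
  assumes pp: "primepow (CARD('a))" and q: "CARD('a) > 4"
    and no_root: "\<And>x. x\<^sup>2 - t * x + n \<noteq> 0"
    and inj: "inj (\<lambda>x. x + (r * x + s) / (x\<^sup>2 - t * x + n))"
    and nz: "r \<noteq> 0 \<or> s \<noteq> 0"
  shows "r = 2 * (4 * n - t\<^sup>2) \<and> s = - (4 * n - t\<^sup>2) * t"
proof -
  obtain z z' where zz': "z \<noteq> z'" "z ^ CARD('a) = z'" "z' ^ CARD('a) = z"
      "z + z' = to_ac t" "z * z' = to_ac n"
    using conjugate_root_alg_closure[OF pp no_root] by blast
  \<comment> \<open>As \<open>z ^ q = z'\<close>, this is the constant
    \<open>1 / (z ^ q - z)\<close> of the power sum formula; for z' it changes sign.\<close>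
  define \<tau> where "\<tau> = 1 / (z' - z)"
  define a where "a = (\<lambda>x. 1 / (to_ac x - z))"
  define b where "b = (\<lambda>x. 1 / (to_ac x - z'))"
  have \<tau>: "\<tau> * (z' - z) = 1" "\<tau> \<noteq> 0"
    using zz' by (auto simp: \<tau>_def)
  have z_ne: "to_ac x \<noteq> z" "to_ac x \<noteq> z'" for x
    using zz' to_ac_power_card[of x] by auto
  have sum_a: "(\<Sum>x\<in>UNIV. a x ^ j) = \<tau> ^ j" if "0 < j" "j \<le> 3" for j
    using sum_inverse_power_to_ac[OF pp _ _ that(1), of z] that q zz' by (simp add: a_def \<tau>_def)
  have "1 / (z - z') = - \<tau>"
    unfolding \<tau>_def by (metis minus_diff_eq minus_divide_right)
  hence sum_b: "(\<Sum>x\<in>UNIV. b x ^ j) = (- \<tau>) ^ j" if "0 < j" "j \<le> 3" for j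
    using sum_inverse_power_to_ac[OF pp _ _ that(1), of z'] that q zz' by (simp add: b_def)
  have sums: "sum a UNIV = \<tau>" "sum b UNIV = - \<tau>"
     "(\<Sum>x\<in>UNIV. (a x)\<^sup>2) = \<tau>\<^sup>2" "(\<Sum>x\<in>UNIV. (b x)\<^sup>2) = \<tau>\<^sup>2"
     "(\<Sum>x\<in>UNIV. a x ^ 3) = \<tau> ^ 3" "(\<Sum>x\<in>UNIV. b x ^ 3) = - (\<tau> ^ 3)"
    using sum_a[of 1] sum_b[of 1] sum_a[of 2] sum_b[of 2] sum_a[of 3] sum_b[of 3] by simp_all
  have sum_X: "(\<Sum>x\<in>(UNIV :: 'a set). to_ac x ^ j) = 0" if "j \<le> 3" for j
    using sum_power_to_ac_inj_eq_0[of "\<lambda>x :: 'a. x" j] that q by simp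
  have card0: "of_nat (CARD('a)) = (0 :: 'a alg_closure)"
    using sum_X[of 0] by simp
  \<comment> \<open>Reduction rules that turn products of \<open>to_ac x\<close>, \<open>a x\<close>
    and \<open>b x\<close> into terms whose sums are known.\<close>
  have Xa: "to_ac x * a x = 1 + z * a x" and Xb: "to_ac x * b x = 1 + z' * b x"
    and ab: "a x * b x = - \<tau> * (a x - b x)" for x
    using z_ne[of x] zz'(1) by (auto simp: a_def b_def \<tau>_def divide_simps)
  define f where "f = (\<lambda>x. x + (r * x + s) / (x\<^sup>2 - t * x + n))"
  \<comment> \<open>The residues of \<open>(r * x + s) / (x\<^sup>2 - t * x + n)\<close> at z and
    z'.\<close>
  define \<alpha> where "\<alpha> = - (to_ac r * z + to_ac s) * \<tau>"
  define \<beta> where "\<beta> = (to_ac r * z' + to_ac s) * \<tau>"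
  have f: "to_ac (f x) = to_ac x + (\<alpha> * a x + \<beta> * b x)" for x
  proof -
    have "to_ac (x\<^sup>2 - t * x + n) = (to_ac x - z) * (to_ac x - z')"
      by (simp add: algebra_simps power2_eq_square flip: zz'(4,5))
    hence "to_ac (f x) = to_ac x + (to_ac r * to_ac x + to_ac s) * (a x * b x)"
      by (simp add: f_def a_def b_def del: to_ac_diff)
    also have "(to_ac r * to_ac x + to_ac s) * (a x * b x) = \<alpha> * a x + \<beta> * b x"
      unfolding ab \<alpha>_def \<beta>_def using Xa[of x] Xb[of x] by Groebner_Basis.algebra
    finally show ?thesis .
  qed
  have sum_f: "(\<Sum>x\<in>UNIV. to_ac (f x) ^ k) = 0" if "k \<le> 3" for k
    using inj that q by (intro sum_power_to_ac_inj_eq_0) (auto simp: f_def)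
  have "(\<Sum>x\<in>UNIV. to_ac (f x)) = \<alpha> * \<tau> - \<beta> * \<tau>"
    unfolding f using sum_X[of 1] by (simp add: sum.distrib sums flip: sum_distrib_left)
  hence \<beta>: "\<beta> = \<alpha>"
    using sum_f[of 1] \<tau>(2) by (simp flip: left_diff_distrib)
  \<comment> \<open>Equal residues make the numerator \<open>\<alpha>\<close> times the derivative
    \<open>2 * x - t\<close> of the denominator.\<close>
  have r: "to_ac r = 2 * \<alpha>" and s: "to_ac s = - \<alpha> * to_ac t"
    using \<beta> \<tau>(1) unfolding \<alpha>_def \<beta>_def zz'(4)[symmetric] by Groebner_Basis.algebra+
  have \<alpha>: "\<alpha> \<noteq> 0"
    using nz r s by auto
  \<comment> \<open>The second power sum carries a factor 2, so characteristic 2 needs the third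
    one.\<close>
  have "\<alpha> * \<tau>\<^sup>2 = -1"
  proof (cases "(2 :: 'a alg_closure) = 0")
    case False
    have "to_ac (f x) ^ 2 = to_ac x ^ 2 + 4 * \<alpha> + 2 * \<alpha> * z * a x + 2 * \<alpha> * z' * b x
        + \<alpha>\<^sup>2 * (a x)\<^sup>2 + \<alpha>\<^sup>2 * (b x)\<^sup>2 - 2 * \<alpha>\<^sup>2 * \<tau> * a x + 2 * \<alpha>\<^sup>2 * \<tau> * b x" for x
      unfolding f \<beta> using Xa[of x] Xb[of x] ab[of x] by Groebner_Basis.algebra
    hence "0 = (\<Sum>x\<in>(UNIV :: 'a set). to_ac x ^ 2 + 4 * \<alpha> + 2 * \<alpha> * z * a x + 2 * \<alpha> * z' * b x
        + \<alpha>\<^sup>2 * (a x)\<^sup>2 + \<alpha>\<^sup>2 * (b x)\<^sup>2 - 2 * \<alpha>\<^sup>2 * \<tau> * a x + 2 * \<alpha>\<^sup>2 * \<tau> * b x)"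
      using sum_f[of 2] by simp
    also have "\<dots> = 2 * \<alpha> * z * \<tau> + 2 * \<alpha> * z' * (- \<tau>) + \<alpha>\<^sup>2 * \<tau>\<^sup>2 + \<alpha>\<^sup>2 * \<tau>\<^sup>2
        - 2 * \<alpha>\<^sup>2 * \<tau> * \<tau> + 2 * \<alpha>\<^sup>2 * \<tau> * (- \<tau>)"
      using sum_X[of 2]
      by (simp add: sum.distrib sum_subtractf sums card0 flip: sum_distrib_left)
    also have "\<dots> = 2 * \<alpha> * (- 1 - \<alpha> * \<tau>\<^sup>2)"
      using \<tau>(1) by Groebner_Basis.algebra
    finally show ?thesis
      using False \<alpha> by simp
  next
    case True
    have mod_2: "2 * y = 0" "3 * y = y" for y :: "'a alg_closure"
    proof -
      show two: "2 * y = 0"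
        using True by simp
      have "3 * y = 2 * y + y"
        by Groebner_Basis.algebra
      thus "3 * y = y"
        unfolding two by (simp only: add_0_left)
    qed
    have "to_ac (f x) ^ 3 = to_ac x ^ 3 + \<alpha> * (to_ac t + z\<^sup>2 * a x + z'\<^sup>2 * b x)
        + \<alpha>\<^sup>2 * (a x + z * (a x)\<^sup>2 + b x + z' * (b x)\<^sup>2)
        + \<alpha> ^ 3 * (a x ^ 3 + b x ^ 3 - 3 * \<tau> * ((a x)\<^sup>2 - (b x)\<^sup>2))" for x
    proof -
      have "to_ac (f x) ^ 3 = to_ac x ^ 3 + 3 * (\<alpha> * ((to_ac x)\<^sup>2 * a x + (to_ac x)\<^sup>2 * b x))
          + 3 * (\<alpha>\<^sup>2 * (to_ac x * (a x)\<^sup>2 + to_ac x * (b x)\<^sup>2 + 2 * (to_ac x * a x * b x)))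
          + \<alpha> ^ 3 * (a x ^ 3 + b x ^ 3 + 3 * (a x * b x) * (a x + b x))"
        unfolding f \<beta> by Groebner_Basis.algebra
      moreover have "(to_ac x)\<^sup>2 * a x + (to_ac x)\<^sup>2 * b x =
          2 * to_ac x + (to_ac t + z\<^sup>2 * a x + z'\<^sup>2 * b x)"
        using Xa[of x] Xb[of x] zz'(4) by Groebner_Basis.algebra
      moreover have "to_ac x * (a x)\<^sup>2 = a x + z * (a x)\<^sup>2" "to_ac x * (b x)\<^sup>2 = b x + z' * (b x)\<^sup>2"
        using Xa[of x] Xb[of x] by Groebner_Basis.algebra+
      moreover have "3 * (a x * b x) * (a x + b x) = - (3 * \<tau> * ((a x)\<^sup>2 - (b x)\<^sup>2))"
        unfolding ab by Groebner_Basis.algebra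
      ultimately show ?thesis
        unfolding mod_2 add_0_left add_0_right by Groebner_Basis.algebra
    qed
    hence "0 = (\<Sum>x\<in>(UNIV :: 'a set). to_ac x ^ 3 + \<alpha> * (to_ac t + z\<^sup>2 * a x + z'\<^sup>2 * b x)
        + \<alpha>\<^sup>2 * (a x + z * (a x)\<^sup>2 + b x + z' * (b x)\<^sup>2)
        + \<alpha> ^ 3 * (a x ^ 3 + b x ^ 3 - 3 * \<tau> * ((a x)\<^sup>2 - (b x)\<^sup>2)))"
      using sum_f[of 3] by simp
    \<comment> \<open>First powers and cubes of a and b have opposite sums, squares have equal ones,
      so \<open>a x + b x\<close>, \<open>a x ^ 3 + b x ^ 3\<close> and
      \<open>(a x)\<^sup>2 - (b x)\<^sup>2\<close> sum to zero; constants vanish because q is zero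
      in the field.\<close>
    also have "\<dots> = \<alpha> * (z\<^sup>2 * \<tau> + z'\<^sup>2 * (- \<tau>)) + \<alpha>\<^sup>2 * (z * \<tau>\<^sup>2 + z' * \<tau>\<^sup>2)"
      using sum_X[of 3]
      by (simp add: sum.distrib sum_subtractf sums card0 flip: sum_distrib_left)
    also have "\<dots> = \<alpha> * (z + z') * (\<alpha> * \<tau>\<^sup>2 - 1)"
      using \<tau>(1) by Groebner_Basis.algebra
    \<comment> \<open>In characteristic 2 this is \<open>z - z'\<close>, a nonzero factor that can
      be cancelled.\<close>
    also have "z + z' = z - z' + 2 * z'"
      by simp
    finally have "\<alpha> * \<tau>\<^sup>2 = 1"
      using zz'(1) \<alpha> unfolding mod_2 by simp
    also have "1 = 2 * 1 + (-1 :: 'a alg_closure)"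
      by simp
    finally show ?thesis
      unfolding mod_2 by simp
  qed
  \<comment> \<open>\<open>1 / \<tau>\<^sup>2\<close> is \<open>(z' - z)\<^sup>2\<close>, the
    discriminant \<open>t\<^sup>2 - 4 * n\<close>, and \<open>\<alpha>\<close> is its
    negative.\<close>
  hence "\<alpha> = 4 * to_ac n - (to_ac t)\<^sup>2"
    using \<tau>(1) unfolding zz'(4,5)[symmetric] by Groebner_Basis.algebra
  hence "to_ac r = to_ac (2 * (4 * n - t\<^sup>2))" "to_ac s = to_ac (- (4 * n - t\<^sup>2) * t)"
    using r s by simp_all
  thus ?thesis
    unfolding to_ac_eq_iff by blast
qed

section \<open>Numerators and denominators of low degree\<close>

text \<open>A numerator of larger degree fixes infinity. What remains is a self-map of the field
  without poles, for which injectivity suffices by finiteness.\<close>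

lemma bij_ratfun_eval_iff:
  fixes V U :: "'a::{field,finite} poly"
  assumes "degree U < degree V"
  shows "bij (ratfun_eval V U) \<longleftrightarrow> (\<forall>x. poly U x \<noteq> 0) \<and> inj (\<lambda>x. poly V x / poly U x)"
proof
  assume bij: "bij (ratfun_eval V U)"
  have nz: "poly U x \<noteq> 0" for x
    using bij[THEN bij_is_inj, THEN injD, of "Some x" None] assms by auto
  moreover have "inj (\<lambda>x. poly V x / poly U x)"
  proof (rule injI)
    fix x y assume "poly V x / poly U x = poly V y / poly U y"
    thus "x = y"
      using bij[THEN bij_is_inj, THEN injD, of "Some x" "Some y"] nz by simp
  qed
  ultimately show "(\<forall>x. poly U x \<noteq> 0) \<and> inj (\<lambda>x. poly V x / poly U x)"
    by blast
next
  assume *: "(\<forall>x. poly U x \<noteq> 0) \<and> inj (\<lambda>x. poly V x / poly U x)"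
  have "inj (ratfun_eval V U)"
  proof (rule injI)
    fix x y assume "ratfun_eval V U x = ratfun_eval V U y"
    thus "x = y"
      using * assms by (cases x; cases y) (auto dest: injD)
  qed
  thus "bij (ratfun_eval V U)"
    by (simp add: bij_def finite_UNIV_inj_surj)
qed

lemma coeff_degree_nonzero: "degree p = n \<Longrightarrow> n > 0 \<Longrightarrow> coeff p n \<noteq> 0"
  by (metis degree_0 leading_coeff_0_iff less_irrefl)

lemma degree_le_3_eq:
  assumes "degree p \<le> 3"
  shows "p = [:coeff p 0, coeff p 1, coeff p 2, coeff p 3:]"
proof (rule poly_eqI)
  fix i
  have "i = 0 \<or> i = 1 \<or> i = 2 \<or> i = 3 \<or> degree p < i"
    using assms by linarith
  thus "coeff p i = coeff [:coeff p 0, coeff p 1, coeff p 2, coeff p 3:] i"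
    using assms by (auto simp: coeff_eq_0 eval_nat_numeral coeff_pCons split: nat.splits)
qed

section \<open>Polynomials of degree one and two\<close>

lemma monic_PRF_pairs_0_right:
  fixes v :: nat
  assumes "v > 0"
  shows "(monic_PRF_pairs v 0 :: ('a::{field,finite} poly \<times> 'a poly) set) =
    {V. degree V = v \<and> inj (poly V)} \<times> {1}"
proof (intro Set.set_eqI iffI)
  fix p :: "'a poly \<times> 'a poly"
  assume p: "p \<in> monic_PRF_pairs v 0"
  obtain V U where [simp]: "p = (V, U)" by (cases p)
  from p have "U = 1"
    by (auto simp: monic_PRF_pairs_def elim!: degree_eq_zeroE)
  thus "p \<in> {V. degree V = v \<and> inj (poly V)} \<times> {1}"
    using p assms by (auto simp: monic_PRF_pairs_def bij_ratfun_eval_iff)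
next
  fix p :: "'a poly \<times> 'a poly"
  assume "p \<in> {V. degree V = v \<and> inj (poly V)} \<times> {1}"
  thus "p \<in> monic_PRF_pairs v 0"
    using assms by (auto simp: monic_PRF_pairs_def bij_ratfun_eval_iff)
qed

lemma card_monic_PRF_pairs_0_right:
  assumes "v > 0"
  shows "card (monic_PRF_pairs v 0 :: ('a::{field,finite} poly \<times> 'a poly) set) =
    card {V :: 'a poly. degree V = v \<and> inj (poly V)}"
  unfolding monic_PRF_pairs_0_right[OF assms] by (simp add: card_cartesian_product)

lemma card_PRF_1_0:
  "card (monic_PRF_pairs 1 0 :: ('a::{field,finite} poly \<times> 'a poly) set) = (CARD('a) - 1) * CARD('a)"
proof -
  have "{V :: 'a poly. degree V = 1 \<and> inj (poly V)} = (\<lambda>(a, b). [:b, a:]) ` ((UNIV - {0}) \<times> UNIV)"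
  proof (intro Set.set_eqI iffI)
    fix V :: "'a poly"
    assume "V \<in> {V. degree V = 1 \<and> inj (poly V)}"
    hence "V = [:coeff V 0, coeff V 1:]" "coeff V 1 \<noteq> 0"
      using degree_le_3_eq[of V] coeff_degree_nonzero[of V 1] by (auto simp: coeff_eq_0)
    thus "V \<in> (\<lambda>(a, b). [:b, a:]) ` ((UNIV - {0}) \<times> UNIV)"
      by (intro image_eqI[of _ _ "(coeff V 1, coeff V 0)"]) auto
  qed (auto intro!: injI)
  moreover have "inj_on (\<lambda>(a, b). [:b, a:]) ((UNIV - {0}) \<times> (UNIV :: 'a set))"
    by (auto intro!: inj_onI)
  ultimately show ?thesis
    by (simp add: card_monic_PRF_pairs_0_right card_image card_cartesian_product)
qed

lemma bij_square_char_2: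
  assumes "(2 :: 'a::{field,finite}) = 0"
  shows "inj (\<lambda>x :: 'a. x\<^sup>2)" "surj (\<lambda>x :: 'a. x\<^sup>2)"
proof -
  show inj: "inj (\<lambda>x :: 'a. x\<^sup>2)"
  proof (rule injI)
    fix x y :: 'a
    assume "x\<^sup>2 = y\<^sup>2"
    hence "(x - y)\<^sup>2 = 2 * (y\<^sup>2 - x * y)"
      by (simp add: power2_eq_square algebra_simps)
    thus "x = y"
      unfolding assms by simp
  qed
  thus "surj (\<lambda>x :: 'a. x\<^sup>2)"
    by (rule finite_UNIV_inj_surj[rotated]) simp
qed

lemma card_PRF_2_0:
  "card (monic_PRF_pairs 2 0 :: ('a::{field,finite} poly \<times> 'a poly) set) =
     (if (2 :: 'a) = 0 then (CARD('a) - 1) * CARD('a) else 0)"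
proof -
  have "{V :: 'a poly. degree V = 2 \<and> inj (poly V)} =
     (if (2 :: 'a) = 0 then (\<lambda>(a, c). [:c, 0, a:]) ` ((UNIV - {0}) \<times> UNIV) else {})"
  proof (intro Set.set_eqI iffI)
    fix V :: "'a poly"
    assume V: "V \<in> {V. degree V = 2 \<and> inj (poly V)}"
    define a b c where abc: "a = coeff V 2" "b = coeff V 1" "c = coeff V 0"
    have V_eq: "V = [:c, b, a:]" and a: "a \<noteq> 0"
      using V degree_le_3_eq[of V] coeff_degree_nonzero[of V 2] by (auto simp: abc coeff_eq_0)
    have inj: "x = y" if "poly V x = poly V y" for x y
      using V that by (auto dest: injD)
    \<comment> \<open>The points 0 and \<open>- b / a\<close> always share a value, which forces
      \<open>b = 0\<close>; then 1 and -1 share a value as well, which forces characteristic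
      2.\<close>
    have b: "b = 0"
      using inj[of 0 "- b / a"] a by (auto simp: V_eq)
    have "(2 :: 'a) = 0"
      using inj[of 1 "- 1"] b by (auto simp: V_eq eq_neg_iff_add_eq_0)
    moreover have "V \<in> (\<lambda>(a, c). [:c, 0, a:]) ` ((UNIV - {0}) \<times> UNIV)"
      using a V_eq b by (intro image_eqI[of _ _ "(a, c)"]) simp_all
    ultimately show "V \<in> (if (2 :: 'a) = 0 then (\<lambda>(a, c). [:c, 0, a:]) ` ((UNIV - {0}) \<times> UNIV) else {})"
      by (simp only: if_True simp_thms)
  next
    fix V :: "'a poly"
    assume "V \<in> (if (2 :: 'a) = 0 then (\<lambda>(a, c). [:c, 0, a:]) ` ((UNIV - {0}) \<times> UNIV) else {})"
    then obtain a c where two: "(2 :: 'a) = 0" and V: "V = [:c, 0, a:]" "a \<noteq> 0"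
      by (auto simp only: split: if_splits)
    have "inj (poly V)"
    proof (rule injI)
      fix x y assume "poly V x = poly V y"
      hence "x\<^sup>2 = y\<^sup>2"
        using V by (simp add: power2_eq_square)
      thus "x = y"
        using bij_square_char_2(1)[OF two] by (rule injD[rotated])
    qed
    thus "V \<in> {V. degree V = 2 \<and> inj (poly V)}"
      using V by simp
  qed
  moreover have "inj_on (\<lambda>(a, c). [:c, 0, a:]) ((UNIV - {0}) \<times> (UNIV :: 'a set))"
    by (auto intro!: inj_onI)
  ultimately show ?thesis
    by (simp add: card_monic_PRF_pairs_0_right card_image card_cartesian_product)
qed

section \<open>Constants and linear denominators\<close>

lemma card_PRF_0_0:
  "card (monic_PRF_pairs 0 0 :: ('a::{field,finite} poly \<times> 'a poly) set) = 0"
proof -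
  have "False" if VU: "(V, U) \<in> monic_PRF_pairs 0 0" for V U :: "'a poly"
  proof -
    from VU obtain a b where "V = [:a:]" "U = [:b:]" "b = 1"
      by (auto simp: monic_PRF_pairs_def elim!: degree_eq_zeroE)
    hence "ratfun_eval V U None = ratfun_eval V U (Some 0)"
      by simp
    moreover have "inj (ratfun_eval V U)"
      using VU by (simp add: monic_PRF_pairs_def bij_def)
    ultimately show False
      using injD[of "ratfun_eval V U" None "Some 0"] by simp
  qed
  hence "monic_PRF_pairs 0 0 = ({} :: ('a poly \<times> 'a poly) set)"
    by auto
  thus ?thesis by simp
qed

text \<open>The root of the denominator would be a second preimage of infinity, which is already
  fixed.\<close>

lemma card_PRF_linear_denominator:
  assumes "v > 1"
  shows "card (monic_PRF_pairs v 1 :: ('a::{field,finite} poly \<times> 'a poly) set) = 0"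
proof -
  have "False" if VU: "(V, U) \<in> monic_PRF_pairs v 1" for V U :: "'a poly"
  proof -
    from VU have deg: "degree U = 1" "degree V = v" and U: "lead_coeff U = 1"
      and bij: "bij (ratfun_eval V U)"
      by (auto simp: monic_PRF_pairs_def)
    obtain c where "U = [:c, 1:]"
      using deg U degree_le_3_eq[of U] by (auto simp: coeff_eq_0)
    hence "poly U (- c) = 0"
      by simp
    thus False
      using bij deg assms by (subst (asm) bij_ratfun_eval_iff) auto
  qed
  hence "monic_PRF_pairs v 1 = ({} :: ('a poly \<times> 'a poly) set)"
    by auto
  thus ?thesis by simp
qed

text \<open>These are Moebius transformations, and \<open>b - a * c\<close> is the determinant up to
  sign.\<close>

lemma bij_ratfun_eval_linear:
  fixes a b c :: "'a::{field,finite}"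
  assumes "b \<noteq> a * c"
  shows "bij (ratfun_eval [:b, a:] [:c, 1:])"
proof -
  have None: "ratfun_eval [:b, a:] [:c, 1:] None = Some a"
    by auto
  have "inj (ratfun_eval [:b, a:] [:c, 1:])"
  proof (rule injI)
    fix x y assume *: "ratfun_eval [:b, a:] [:c, 1:] x = ratfun_eval [:b, a:] [:c, 1:] y"
    have 1: "u = w" if "(b + u * a) / (c + u) = (b + w * a) / (c + w)" "c + u \<noteq> 0" "c + w \<noteq> 0" for u w
    proof -
      have "(b - a * c) * (u - w) = 0"
        using that by (simp add: divide_simps) Groebner_Basis.algebra
      thus ?thesis using assms by simp
    qed
    have 2: False if "(b + u * a) / (c + u) = a" "c + u \<noteq> 0" for u
      using that assms by (auto simp: divide_simps algebra_simps)
    have 3: "u = w" if "c + u = 0" "c + w = 0" for u w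
      using that by (metis add_left_cancel)
    show "x = y"
    proof (cases x; cases y)
      fix u w assume "x = Some u" "y = Some w"
      thus ?thesis
        using * 1[of u w] 3[of u w] by (auto split: if_splits)
    next
      fix u assume "x = Some u" "y = None"
      thus ?thesis
        using * 2[of u] unfolding None by (auto split: if_splits)
    next
      fix u assume "x = None" "y = Some u"
      thus ?thesis
        using * 2[of u] unfolding None by (auto split: if_splits)
    qed simp
  qed
  thus ?thesis
    by (simp add: bij_def finite_UNIV_inj_surj)
qed

lemma coprime_linear_iff:
  fixes a b c :: "'a::field"
  shows "coprime [:b, a:] [:c, 1:] \<longleftrightarrow> b \<noteq> a * c"
proof
  assume cop: "coprime [:b, a:] [:c, 1:]"
  show "b \<noteq> a * c"
  proof
    assume "b = a * c"
    hence "[:b, a:] = smult a [:c, 1:]" by simp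
    hence "[:c, 1:] dvd [:b, a:]"
      by (simp only: dvd_smult[OF dvd_refl])
    hence "is_unit [:c, 1:]"
      by (rule coprime_common_divisor[OF cop _ dvd_refl])
    thus False
      by (simp add: is_unit_iff_degree)
  qed
next
  assume "b \<noteq> a * c"
  show "coprime [:b, a:] [:c, 1:]"
  proof (rule coprimeI)
    fix d assume d: "d dvd [:b, a:]" "d dvd [:c, 1:]"
    have "d dvd [:b, a:] - smult a [:c, 1:]"
      by (rule dvd_diff[OF d(1) dvd_smult[OF d(2)]])
    also have "[:b, a:] - smult a [:c, 1:] = [:b - a * c:]"
      by simp
    finally have "d dvd [:b - a * c:]" .
    moreover have "is_unit [:b - a * c:]"
      using \<open>b \<noteq> a * c\<close> by (simp add: is_unit_iff_degree)
    ultimately show "is_unit d"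
      by (rule dvd_unit_imp_unit)
  qed
qed

text \<open>Numerator degrees 0 and 1 are treated at once:
  \<open>a = 0 \<longleftrightarrow> v = 0\<close> picks the degree, and the determinant condition
  makes the numerator nonzero and the pair coprime.\<close>

lemma monic_PRF_pairs_linear:
  assumes "v \<le> 1"
  shows "(monic_PRF_pairs v 1 :: ('a::{field,finite} poly \<times> 'a poly) set) =
    (\<lambda>(a, b, c). ([:b, a:], [:c, 1:])) ` {(a, b, c). b \<noteq> a * c \<and> (a = 0 \<longleftrightarrow> v = 0)}"
proof (intro Set.set_eqI iffI)
  fix p :: "'a poly \<times> 'a poly"
  assume p: "p \<in> monic_PRF_pairs v 1"
  obtain V U where VU: "p = (V, U)" by (cases p)
  have deg: "degree U = 1" "degree V = v" and U: "lead_coeff U = 1" and "V \<noteq> 0" and cop: "coprime V U"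
    using p by (auto simp: VU monic_PRF_pairs_def)
  have U: "U = [:coeff U 0, 1:]"
    using deg U degree_le_3_eq[of U] by (auto simp: coeff_eq_0)
  have V: "V = [:coeff V 0, coeff V 1:]"
    using deg assms degree_le_3_eq[of V] by (auto simp: coeff_eq_0)
  have "coeff V 1 = 0 \<longleftrightarrow> v = 0"
    using deg(2) assms coeff_degree_nonzero[of V v] by (cases v) (auto simp: coeff_eq_0)
  moreover have "coeff V 0 \<noteq> coeff V 1 * coeff U 0"
    using cop U V coprime_linear_iff by metis
  ultimately show "p \<in> (\<lambda>(a, b, c). ([:b, a:], [:c, 1:])) ` {(a, b, c). b \<noteq> a * c \<and> (a = 0 \<longleftrightarrow> v = 0)}"
    using U V unfolding VU by (intro image_eqI[of _ _ "(coeff V 1, coeff V 0, coeff U 0)"]) auto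
next
  fix p :: "'a poly \<times> 'a poly"
  assume "p \<in> (\<lambda>(a, b, c). ([:b, a:], [:c, 1:])) ` {(a, b, c). b \<noteq> a * c \<and> (a = 0 \<longleftrightarrow> v = 0)}"
  then obtain a b c where abc: "p = ([:b, a:], [:c, 1:])" "b \<noteq> a * c" "a = 0 \<longleftrightarrow> v = 0"
    by auto
  thus "p \<in> monic_PRF_pairs v 1"
    using assms coprime_linear_iff[of b a c] bij_ratfun_eval_linear[OF abc(2)]
    by (auto simp: monic_PRF_pairs_def)
qed

lemma card_monic_PRF_pairs_linear:
  assumes "v \<le> 1"
  shows "card (monic_PRF_pairs v 1 :: ('a::{field,finite} poly \<times> 'a poly) set) =
    card {(a :: 'a, b, c). b \<noteq> a * c \<and> (a = 0 \<longleftrightarrow> v = 0)}"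
proof -
  have "inj_on (\<lambda>(a, b, c). ([:b, a:], [:c, 1 :: 'a:])) A" for A
    by (auto intro!: inj_onI)
  thus ?thesis
    unfolding monic_PRF_pairs_linear[OF assms] by (rule card_image)
qed

lemma card_PRF_0_1:
  "card (monic_PRF_pairs 0 1 :: ('a::{field,finite} poly \<times> 'a poly) set) = (CARD('a) - 1) * CARD('a)"
proof -
  have "{(a :: 'a, b, c :: 'a). b \<noteq> a * c \<and> (a = 0 \<longleftrightarrow> (0 :: nat) = 0)} = {0} \<times> (UNIV - {0}) \<times> UNIV"
    by auto
  hence "card (monic_PRF_pairs 0 1 :: ('a poly \<times> 'a poly) set) = card ({0 :: 'a} \<times> (UNIV - {0 :: 'a}) \<times> (UNIV :: 'a set))"
    using card_monic_PRF_pairs_linear[of 0, where ?'a = 'a] by simp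
  thus ?thesis
    by (simp add: card_cartesian_product)
qed

lemma card_PRF_1_1:
  "card (monic_PRF_pairs 1 1 :: ('a::{field,finite} poly \<times> 'a poly) set) = (CARD('a) - 1)\<^sup>2 * CARD('a)"
proof -
  \<comment> \<open>The shear makes the determinant \<open>b - a * c\<close> a free nonzero
    coordinate.\<close>
  have "{(a :: 'a, b, c :: 'a). b \<noteq> a * c \<and> (a = 0 \<longleftrightarrow> (1 :: nat) = 0)} =
      (\<lambda>(a, b, c). (a, b + a * c, c)) ` ((UNIV - {0}) \<times> (UNIV - {0}) \<times> UNIV)"
  proof (intro Set.set_eqI iffI)
    fix p :: "'a \<times> 'a \<times> 'a"
    assume "p \<in> {(a, b, c). b \<noteq> a * c \<and> (a = 0 \<longleftrightarrow> (1 :: nat) = 0)}"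
    then obtain a b c where "p = (a, b, c)" "b - a * c \<noteq> 0" "a \<noteq> 0"
      by auto
    thus "p \<in> (\<lambda>(a, b, c). (a, b + a * c, c)) ` ((UNIV - {0}) \<times> (UNIV - {0}) \<times> UNIV)"
      by (intro image_eqI[of _ _ "(a, b - a * c, c)"]) simp_all
  qed auto
  moreover have "inj_on (\<lambda>(a, b, c). (a, b + a * c, c)) ((UNIV - {0}) \<times> (UNIV - {0}) \<times> (UNIV :: 'a set))"
    by (auto intro!: inj_onI)
  ultimately have "card {(a :: 'a, b, c :: 'a). b \<noteq> a * c \<and> (a = 0 \<longleftrightarrow> (1 :: nat) = 0)} =
      card ((UNIV - {0 :: 'a}) \<times> (UNIV - {0 :: 'a}) \<times> (UNIV :: 'a set))"
    by (simp add: card_image)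
  thus ?thesis
    using card_monic_PRF_pairs_linear[of 1, where ?'a = 'a]
    by (simp add: card_cartesian_product power2_eq_square)
qed

section \<open>Cubic permutation polynomials\<close>

lemma card_image_2_to_1:
  assumes "finite A" "\<And>y. y \<in> f ` A \<Longrightarrow> card {x \<in> A. f x = y} = 2"
  shows "card A = 2 * card (f ` A)"
proof -
  have "card A = (\<Sum>y\<in>f ` A. card {x \<in> A. f x = y})"
    using sum.image_gen[OF assms(1), of "\<lambda>_. 1 :: nat" f] by simp
  thus ?thesis
    using assms(2) by simp
qed

text \<open>Hermite's criterion with exponent k = (q - 1) / 3: \<open>V ^ k\<close> has degree
  exactly q - 1, so its sum over the field is minus a nonzero leading coefficient, while a
  permutation would give 0.\<close>

lemma cubic_not_inj_if_card_mod_3_eq_1: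
  fixes V :: "'a::{field,finite} poly"
  assumes "CARD('a) mod 3 = 1" "CARD('a) > 3" "degree V = 3"
  shows "\<not> inj (poly V)"
proof
  assume inj: "inj (poly V)"
  define k where "k = (CARD('a) - 1) div 3"
  have k: "3 * k = CARD('a) - 1"
    using assms(1) unfolding k_def by presburger
  have "V \<noteq> 0"
    using assms(3) by auto
  hence deg: "degree (V ^ k) = CARD('a) - 1"
    using assms(3) k by (simp add: degree_power_eq)
  have "(\<Sum>x\<in>UNIV. poly (V ^ k) x) = - coeff (V ^ k) (CARD('a) - 1)"
    using deg assms(2) by (intro sum_poly_finite_field) auto
  moreover have "(\<Sum>x\<in>UNIV. poly (V ^ k) x) = 0"
    using sum_power_inj_eq_0[OF inj, of k] k assms(2) by (simp add: poly_power)
  moreover have "coeff (V ^ k) (CARD('a) - 1) \<noteq> 0"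
    using deg \<open>V \<noteq> 0\<close> by (metis leading_coeff_0_iff power_not_zero)
  ultimately show False
    by simp
qed

text \<open>Hermite's criterion with exponent k = (q + 1) / 3. The expansion has the monomials
  \<open>x ^ (k + 2 * i)\<close>, of which only \<open>i = k - 1\<close> has exponent q - 1; its
  coefficient \<open>k * a ^ (k - 1) * m\<close> must vanish.\<close>

lemma depressed_cubic_inj_imp:
  fixes a m :: "'a::{field,finite}"
  assumes mod: "CARD('a) mod 3 = 2" and q: "CARD('a) > 3"
    and inj: "inj (\<lambda>x. a * x ^ 3 + m * x)" and a: "a \<noteq> 0"
  shows "m = 0"
proof -
  define k where "k = (CARD('a) + 1) div 3"
  have k: "3 * k = CARD('a) + 1"
    using mod unfolding k_def by presburger
  have sum: "(\<Sum>x\<in>UNIV. x ^ (k + 2 * i)) = (if i = k - 1 then - 1 else 0 :: 'a)" if "i \<le> k" for i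
  proof -
    have "i = k - 1 \<or> i = k \<and> i \<noteq> k - 1 \<or> i < k - 1"
      using that by arith
    then consider "i = k - 1" | "i = k" "i \<noteq> k - 1" | "i < k - 1"
      by blast
    thus ?thesis
    proof cases
      case 1
      hence "k + 2 * i = CARD('a) - 1"
        using k q by simp
      thus ?thesis
        using sum_power_card_minus_1[where ?'a = 'a] q 1 by simp
    next
      \<comment> \<open>The exponent q + 1 is beyond the vanishing range, but
        \<open>x ^ (q + 1) = x\<^sup>2\<close>.\<close>
      case 2
      hence "x ^ (k + 2 * i) = x ^ 2" for x :: 'a
        using k finite_field_power_card[of x] by (simp add: power2_eq_square)
      thus ?thesis
        using sum_power_finite_field[of 2, where ?'a = 'a] q 2 by simp
    next
      case 3
      hence "k + 2 * i < CARD('a) - 1"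
        using k by linarith
      thus ?thesis
        using sum_power_finite_field[of "k + 2 * i", where ?'a = 'a] 3 by simp
    qed
  qed
  have "(a * x ^ 3 + m * x) ^ k = (\<Sum>i\<le>k. of_nat (k choose i) * a ^ i * m ^ (k - i) * x ^ (k + 2 * i))" for x
  proof -
    have "(x ^ 3) ^ i * x ^ (k - i) = x ^ (k + 2 * i)" if "i \<le> k" for i
      using that by (simp add: add.commute flip: power_mult power_add)
    thus ?thesis
      unfolding binomial_ring power_mult_distrib
      by (intro sum.cong refl) (simp add: mult_ac)
  qed
  hence "(\<Sum>x\<in>UNIV. (a * x ^ 3 + m * x) ^ k) =
      (\<Sum>i\<le>k. of_nat (k choose i) * a ^ i * m ^ (k - i) * (\<Sum>x\<in>UNIV. x ^ (k + 2 * i)))"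
    by (simp only: sum_distrib_left sum.swap[where A = UNIV])
  also have "\<dots> = (\<Sum>i\<le>k. if i = k - 1 then - (of_nat (k choose i) * a ^ i * m ^ (k - i)) else 0)"
    by (intro sum.cong refl) (simp add: sum)
  also have "\<dots> = - (of_nat k * a ^ (k - 1) * m)"
    using k by (cases k) auto
  finally have "of_nat k * a ^ (k - 1) * m = 0"
    using sum_power_inj_eq_0[OF inj, of k] k q by simp
  \<comment> \<open>In the field \<open>3 * k = q + 1 = 1\<close>, so k is invertible.\<close>
  moreover have "of_nat k \<noteq> (0 :: 'a)"
  proof
    assume "of_nat k = (0 :: 'a)"
    hence "of_nat (3 * k) = (0 :: 'a)" by simp
    thus False
      unfolding k by (simp add: of_nat_card_finite_field)
  qed
  ultimately show ?thesis
    using a by simp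
qed

text \<open>Since 3 j = 2 (q - 1) + 1, raising to the power j inverts cubing. Splitting the exponent
  into q and q - 1 covers \<open>x = 0\<close> as well.\<close>

lemma inj_cube:
  assumes "CARD('a::{field,finite}) mod 3 = 2"
  shows "inj (\<lambda>x :: 'a. x ^ 3)"
proof -
  define j where "j = (2 * CARD('a) - 1) div 3"
  have j: "3 * j = CARD('a) + (CARD('a) - 1)"
    using assms unfolding j_def by presburger
  have "(x ^ 3) ^ j = x" for x :: 'a
  proof -
    have "(x ^ 3) ^ j = x ^ CARD('a) * x ^ (CARD('a) - 1)"
      unfolding power_mult[symmetric] j power_add ..
    also have "\<dots> = x ^ Suc (CARD('a) - 1)"
      by (simp only: finite_field_power_card power_Suc)
    also have "Suc (CARD('a) - 1) = CARD('a)"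
      by (simp add: finite_UNIV_card_ge_0)
    finally show ?thesis
      by (simp add: finite_field_power_card)
  qed
  thus ?thesis
    by (metis injI)
qed

lemma cubic_PRF_eq_shifted_cubes:
  assumes mod: "CARD('a::{field,finite}) mod 3 = 2" and q: "CARD('a) > 3" and three: "(3 :: 'a) \<noteq> 0"
  shows "{V :: 'a poly. degree V = 3 \<and> inj (poly V)} =
    (\<lambda>(a, e, d). [:a * e ^ 3 + d, 3 * a * e\<^sup>2, 3 * a * e, a:]) ` ((UNIV - {0}) \<times> UNIV \<times> UNIV)"
proof (intro Set.set_eqI iffI)
  fix V :: "'a poly"
  assume V: "V \<in> {V. degree V = 3 \<and> inj (poly V)}"
  define a b c d where abcd: "a = coeff V 3" "b = coeff V 2" "c = coeff V 1" "d = coeff V 0"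
  have V_eq: "V = [:d, c, b, a:]" and a: "a \<noteq> 0"
    using V degree_le_3_eq[of V] coeff_degree_nonzero[of V 3] by (auto simp: abcd)
  define e where "e = b / (3 * a)"
  have b: "b = 3 * a * e"
    using a three by (simp add: e_def)
  have "inj (\<lambda>x. a * x ^ 3 + (c - 3 * a * e\<^sup>2) * x)"
  proof (rule injI)
    fix x y
    assume *: "a * x ^ 3 + (c - 3 * a * e\<^sup>2) * x = a * y ^ 3 + (c - 3 * a * e\<^sup>2) * y"
    have "poly V (z - e) = a * z ^ 3 + (c - 3 * a * e\<^sup>2) * z + (2 * a * e ^ 3 - c * e + d)" for z
      unfolding V_eq b by simp Groebner_Basis.algebra
    hence "poly V (x - e) = poly V (y - e)"
      by (simp only: *)
    hence "x - e = y - e"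
      using injD[of "poly V" "x - e" "y - e"] V by simp
    thus "x = y" by simp
  qed
  hence "c - 3 * a * e\<^sup>2 = 0"
    by (rule depressed_cubic_inj_imp[OF mod q _ a])
  hence "V = [:a * e ^ 3 + (d - a * e ^ 3), 3 * a * e\<^sup>2, 3 * a * e, a:]"
    unfolding V_eq b by simp
  thus "V \<in> (\<lambda>(a, e, d). [:a * e ^ 3 + d, 3 * a * e\<^sup>2, 3 * a * e, a:]) ` ((UNIV - {0}) \<times> UNIV \<times> UNIV)"
    using a by (intro image_eqI[of _ _ "(a, e, d - a * e ^ 3)"]) simp_all
next
  fix V :: "'a poly"
  assume "V \<in> (\<lambda>(a, e, d). [:a * e ^ 3 + d, 3 * a * e\<^sup>2, 3 * a * e, a:]) ` ((UNIV - {0}) \<times> UNIV \<times> UNIV)"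
  then obtain a e d where V: "V = [:a * e ^ 3 + d, 3 * a * e\<^sup>2, 3 * a * e, a:]" and a: "a \<noteq> 0"
    by auto
  have "inj (poly V)"
  proof (rule injI)
    fix x y assume *: "poly V x = poly V y"
    have "poly V z = a * (z + e) ^ 3 + d" for z
      unfolding V by simp Groebner_Basis.algebra
    hence "(x + e) ^ 3 = (y + e) ^ 3"
      using * a by simp
    hence "x + e = y + e"
      by (rule injD[OF inj_cube[OF mod]])
    thus "x = y" by simp
  qed
  thus "V \<in> {V. degree V = 3 \<and> inj (poly V)}"
    using V a by simp
qed

text \<open>In characteristic 3 the map \<open>a * x ^ 3 + c * x\<close> is additive, so injectivity
  means trivial kernel. What remains is to exclude a quadratic term.\<close>

lemma cubic_PRF_char_3:
  assumes three: "(3 :: 'a::{field,finite}) = 0"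
  shows "{V :: 'a poly. degree V = 3 \<and> inj (poly V)} =
    (\<lambda>((a, c), d). [:d, c, 0, a:]) ` ({(a, c). a \<noteq> 0 \<and> (\<forall>x. x \<noteq> 0 \<longrightarrow> a * x\<^sup>2 + c \<noteq> 0)} \<times> UNIV)"
proof -
  have mod_3: "3 * x = 0" for x :: 'a
    unfolding three by simp
  show ?thesis
  proof (intro Set.set_eqI iffI)
    fix V :: "'a poly"
    assume V: "V \<in> {V. degree V = 3 \<and> inj (poly V)}"
    define a b c d where abcd: "a = coeff V 3" "b = coeff V 2" "c = coeff V 1" "d = coeff V 0"
    have V_eq: "V = [:d, c, b, a:]" and a: "a \<noteq> 0"
      using V degree_le_3_eq[of V] coeff_degree_nonzero[of V 3] by (auto simp: abcd)
    have inj: "x = y" if "poly V x = poly V y" for x y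
      using injD[of "poly V" x y] V that by simp
    have b: "b = 0"
    proof (rule ccontr)
      assume "b \<noteq> 0"
      \<comment> \<open>In characteristic 3 the values at \<open>e - u\<close> and \<open>e\<close>
        differ by \<open>u\<^sup>2 * (b - a * u) + u * (b * e - c)\<close>; both brackets vanish for
        this choice.\<close>
      define e u where "e = c / b" and "u = b / a"
      have c: "c = e * b" and u: "b = u * a"
        using \<open>b \<noteq> 0\<close> a by (auto simp: e_def u_def)
      have "poly V (e - u) - poly V e = 3 * (a * (e * u\<^sup>2 - e\<^sup>2 * u) - e * u * b)"
        unfolding V_eq c u by simp Groebner_Basis.algebra
      hence "poly V (e - u) = poly V e"
        unfolding mod_3 by simp
      hence "e - u = e"
        by (rule inj)
      thus False
        using \<open>b \<noteq> 0\<close> u by simp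
    qed
    have "a * x\<^sup>2 + c \<noteq> 0" if "x \<noteq> 0" for x
    proof
      assume *: "a * x\<^sup>2 + c = 0"
      have "poly V x = x * (a * x\<^sup>2 + c) + poly V 0"
        unfolding V_eq b by (simp add: algebra_simps power2_eq_square)
      hence "poly V x = poly V 0"
        unfolding * by simp
      hence "x = 0"
        by (rule inj)
      thus False using that by simp
    qed
    thus "V \<in> (\<lambda>((a, c), d). [:d, c, 0, a:]) ` ({(a, c). a \<noteq> 0 \<and> (\<forall>x. x \<noteq> 0 \<longrightarrow> a * x\<^sup>2 + c \<noteq> 0)} \<times> UNIV)"
      using a unfolding V_eq b by (intro image_eqI[of _ _ "((a, c), d)"]) simp_all
  next
    fix V :: "'a poly"
    assume "V \<in> (\<lambda>((a, c), d). [:d, c, 0, a:]) ` ({(a, c). a \<noteq> 0 \<and> (\<forall>x. x \<noteq> 0 \<longrightarrow> a * x\<^sup>2 + c \<noteq> 0)} \<times> UNIV)"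
    then obtain a c d where V: "V = [:d, c, 0, a:]" "a \<noteq> 0" and *: "\<And>x. x \<noteq> 0 \<Longrightarrow> a * x\<^sup>2 + c \<noteq> 0"
      by auto
    have "inj (poly V)"
    proof (rule injI, rule ccontr)
      fix x y assume "poly V x = poly V y" "x \<noteq> y"
      have "poly V x = (x - y) * (a * (x - y)\<^sup>2 + c) + poly V y + 3 * (a * (x\<^sup>2 * y - x * y\<^sup>2))"
        unfolding V by simp Groebner_Basis.algebra
      thus False
        using * \<open>poly V x = poly V y\<close> \<open>x \<noteq> y\<close> unfolding mod_3 by simp
    qed
    thus "V \<in> {V. degree V = 3 \<and> inj (poly V)}"
      using V by simp
  qed
qed

lemma card_nonzero_square_multiples:
  fixes a :: "'a::{field,finite}"
  assumes "(2 :: 'a) \<noteq> 0" "a \<noteq> 0"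
  shows "2 * card ((\<lambda>x. a * x\<^sup>2) ` (UNIV - {0})) = CARD('a) - 1"
proof -
  have "card (UNIV - {0 :: 'a}) = 2 * card ((\<lambda>x. a * x\<^sup>2) ` (UNIV - {0}))"
  proof (rule card_image_2_to_1)
    fix y assume "y \<in> (\<lambda>x. a * x\<^sup>2) ` (UNIV - {0})"
    then obtain z where z: "y = a * z\<^sup>2" "z \<noteq> 0" by auto
    have "{x \<in> UNIV - {0}. a * x\<^sup>2 = y} = {z, - z}"
      using z assms(2) by (auto simp: power2_eq_iff)
    moreover have "z \<noteq> - z"
    proof
      assume "z = - z"
      hence "2 * z = 0"
        by (metis add.right_inverse mult_2)
      thus False
        using assms(1) z(2) by simp
    qed
    ultimately show "card {x \<in> UNIV - {0}. a * x\<^sup>2 = y} = 2"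
      by simp
  qed simp
  thus ?thesis by simp
qed

text \<open>For each leading coefficient \<open>a\<close> the excluded \<open>c\<close> are the (q -
  1) / 2 values \<open>- a * x\<^sup>2\<close> with \<open>x \<noteq> 0\<close>, so (q + 1) / 2
  remain, and \<open>d\<close> is free. The factor 2 avoids division.\<close>

lemma card_PRF_3_0_char_3:
  assumes "(3 :: 'a::{field,finite}) = 0" "(2 :: 'a) \<noteq> 0"
  shows "2 * card (monic_PRF_pairs 3 0 :: ('a poly \<times> 'a poly) set) = (CARD('a) - 1) * (CARD('a) + 1) * CARD('a)"
proof -
  define S where "S = {(a :: 'a, c). a \<noteq> 0 \<and> (\<forall>x. x \<noteq> 0 \<longrightarrow> a * x\<^sup>2 + c \<noteq> 0)}"
  have "S = (SIGMA a:UNIV - {0}. UNIV - (\<lambda>x. - a * x\<^sup>2) ` (UNIV - {0}))"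
  proof -
    have "c = - a * x\<^sup>2 \<longleftrightarrow> a * x\<^sup>2 + c = 0" for a c x :: 'a
      by (simp add: eq_neg_iff_add_eq_0 add.commute)
    thus ?thesis
      by (force simp: S_def)
  qed
  hence "card S = (\<Sum>a\<in>UNIV - {0 :: 'a}. card (UNIV - (\<lambda>x. - a * x\<^sup>2) ` (UNIV - {0})))"
    by simp
  also have "2 * \<dots> = (\<Sum>a\<in>UNIV - {0 :: 'a}. CARD('a) + 1)"
    unfolding sum_distrib_left
  proof (rule sum.cong)
    fix a :: 'a assume "a \<in> UNIV - {0}"
    hence "2 * card ((\<lambda>x. - a * x\<^sup>2) ` (UNIV - {0})) = CARD('a) - 1"
      using card_nonzero_square_multiples[OF assms(2), of "- a"] by simp
    moreover have "card (UNIV - (\<lambda>x. - a * x\<^sup>2) ` (UNIV - {0})) =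
        CARD('a) - card ((\<lambda>x. - a * x\<^sup>2) ` (UNIV - {0}))"
      by (simp add: card_Diff_subset)
    moreover have "CARD('a) > 0"
      by (simp add: finite_UNIV_card_ge_0)
    ultimately show "2 * card (UNIV - (\<lambda>x. - a * x\<^sup>2) ` (UNIV - {0})) = CARD('a) + 1"
      by linarith
  qed simp
  finally have card_S: "2 * card S = (CARD('a) - 1) * (CARD('a) + 1)"
    by simp
  have "card (monic_PRF_pairs 3 0 :: ('a poly \<times> 'a poly) set) =
      card ((\<lambda>((a, c), d). [:d, c, 0, a:]) ` (S \<times> UNIV))"
    unfolding S_def
    by (simp only: card_monic_PRF_pairs_0_right[OF zero_less_numeral] cubic_PRF_char_3[OF assms(1)])
  also have "\<dots> = card (S \<times> (UNIV :: 'a set))"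
    by (intro card_image inj_onI) auto
  finally show ?thesis
    by (simp only: card_cartesian_product mult.assoc[symmetric] card_S)
qed

lemma card_PRF_3_0_mod_1:
  assumes "CARD('a::{field,finite}) mod 3 = 1" "CARD('a) > 3"
  shows "card (monic_PRF_pairs 3 0 :: ('a poly \<times> 'a poly) set) = 0"
proof -
  have "{V :: 'a poly. degree V = 3 \<and> inj (poly V)} = {}"
    using cubic_not_inj_if_card_mod_3_eq_1[OF assms] by blast
  thus ?thesis
    by (simp only: card_monic_PRF_pairs_0_right[OF zero_less_numeral] card.empty)
qed

lemma card_PRF_3_0_mod_2:
  assumes "CARD('a::{field,finite}) mod 3 = 2" "CARD('a) > 3" "(3 :: 'a) \<noteq> 0"
  shows "card (monic_PRF_pairs 3 0 :: ('a poly \<times> 'a poly) set) = (CARD('a) - 1) * (CARD('a))\<^sup>2"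
proof -
  have "inj_on (\<lambda>(a, e, d). [:a * e ^ 3 + d, 3 * a * e\<^sup>2, 3 * a * e, a:])
      ((UNIV - {0 :: 'a}) \<times> UNIV \<times> UNIV)"
    using assms(3) by (auto intro!: inj_onI)
  thus ?thesis
    by (simp add: card_monic_PRF_pairs_0_right cubic_PRF_eq_shifted_cubes[OF assms] card_image
        card_cartesian_product power2_eq_square)
qed

section \<open>Cubics over irreducible quadratics\<close>

text \<open>The monic irreducible quadratics, encoded by trace and norm of a root.\<close>

definition rootless_quadratics :: "('a::field \<times> 'a) set" where
  "rootless_quadratics = {(t, n). \<forall>x. x\<^sup>2 - t * x + n \<noteq> 0}"

text \<open>Quadratics with a root are images of ordered root pairs under the Vieta map
  \<open>g\<close>, which is two-to-one off the diagonal and injective on it. This leaves q^2 - (q^2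
  - q) / 2 - q.\<close>

lemma card_rootless_quadratics:
  "2 * card (rootless_quadratics :: ('a::{field,finite} \<times> 'a) set) = CARD('a) * (CARD('a) - 1)"
proof -
  define g where "g = (\<lambda>(x :: 'a, y). (x + y, x * y))"
  define P where "P = {(x :: 'a, y). x \<noteq> y}"
  define D where "D = (\<lambda>x :: 'a. (x, x)) ` UNIV"
  have g_eq: "(u = x \<and> w = y) \<or> (u = y \<and> w = x)" if "g (u, w) = g (x, y)" for u w x y
  proof -
    have sum: "u + w = x + y" and "u * w = x * y"
      using that by (auto simp: g_def)
    hence "(u - x) * (u - y) = 0"
      by Groebner_Basis.algebra
    thus ?thesis
      using sum by auto
  qed
  have card_UNIV: "card (UNIV :: ('a \<times> 'a) set) = CARD('a) * CARD('a)"
    unfolding UNIV_Times_UNIV[symmetric] by (rule card_cartesian_product)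
  have "P = UNIV - D"
    by (auto simp: P_def D_def)
  moreover have card_D: "card D = CARD('a)"
    unfolding D_def by (intro card_image injI) simp
  ultimately have card_P: "card P = CARD('a) * CARD('a) - CARD('a)"
    by (simp add: card_Diff_subset card_UNIV)
  have "card P = 2 * card (g ` P)"
  proof (rule card_image_2_to_1)
    fix p assume "p \<in> g ` P"
    then obtain x y where p: "p = g (x, y)" "x \<noteq> y"
      by (auto simp: P_def)
    have "{z \<in> P. g z = p} = {(x, y), (y, x)}"
      using p g_eq by (auto simp: P_def) (auto simp: g_def add.commute mult.commute)
    thus "card {z \<in> P. g z = p} = 2"
      using p by simp
  qed simp
  moreover have "card (g ` D) = CARD('a)"
    unfolding card_D[symmetric] by (intro card_image inj_onI) (use g_eq in \<open>auto simp: D_def\<close>)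
  moreover have "g ` P \<inter> g ` D = {}"
  proof (intro equals0I)
    fix p assume "p \<in> g ` P \<inter> g ` D"
    then obtain x y z where "x \<noteq> y" "g (x, y) = g (z, z)"
      by (auto simp: P_def D_def)
    thus False
      using g_eq by blast
  qed
  moreover have rootless: "rootless_quadratics = UNIV - (g ` P \<union> g ` D)"
  proof (intro Set.set_eqI iffI)
    fix p :: "'a \<times> 'a"
    assume p: "p \<in> rootless_quadratics"
    have "p \<noteq> g (x, y)" for x y
    proof
      assume "p = g (x, y)"
      moreover have "x\<^sup>2 - (x + y) * x + x * y = 0"
        by (simp add: algebra_simps power2_eq_square)
      ultimately show False
        using p by (auto simp: rootless_quadratics_def g_def)
    qed
    thus "p \<in> UNIV - (g ` P \<union> g ` D)"
      by force
  next
    fix p :: "'a \<times> 'a"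
    assume p: "p \<in> UNIV - (g ` P \<union> g ` D)"
    have "x\<^sup>2 - t * x + n \<noteq> 0" if "p = (t, n)" for t n x
    proof
      assume "x\<^sup>2 - t * x + n = 0"
      hence "x * (t - x) = n"
        by (simp add: algebra_simps power2_eq_square)
      hence "p = g (x, t - x)"
        by (simp add: that g_def)
      moreover have "(x, t - x) \<in> P \<union> D"
        by (auto simp: P_def D_def)
      ultimately show False
        using p by blast
    qed
    thus "p \<in> rootless_quadratics"
      by (auto simp: rootless_quadratics_def)
  qed
  moreover have "card (rootless_quadratics :: ('a \<times> 'a) set) = CARD('a) * CARD('a) - card (g ` P \<union> g ` D)"
    unfolding rootless by (simp only: card_Diff_subset[OF finite subset_UNIV] card_UNIV)
  ultimately have "card (rootless_quadratics :: ('a \<times> 'a) set) = CARD('a) * CARD('a) - (card (g ` P) + CARD('a))"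
    "2 * card (g ` P) = CARD('a) * CARD('a) - CARD('a)"
    using card_P by (simp_all add: card_Un_disjoint)
  thus ?thesis
    by (simp add: diff_mult_distrib2)
qed

text \<open>A vanishing discriminant yields a double root: \<open>t / 2\<close> outside
  characteristic 2; in characteristic 2 it forces \<open>t = 0\<close>, and \<open>- n\<close> is a
  square.\<close>

lemma rootless_quadratic_discriminant:
  assumes "(t, n) \<in> (rootless_quadratics :: ('a::{field,finite} \<times> 'a) set)"
  shows "4 * n - t\<^sup>2 \<noteq> 0"
proof
  assume disc: "4 * n - t\<^sup>2 = 0"
  have no_root: "x\<^sup>2 - t * x + n \<noteq> 0" for x
    using assms by (auto simp: rootless_quadratics_def)
  show False
  proof (cases "(2 :: 'a) = 0")
    case True
    hence "4 * n = 0"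
      by (metis mult_zero_left numeral_Bit0 mult_2 add.right_neutral)
    hence "t\<^sup>2 = 0"
      using disc by (simp only: diff_0 neg_equal_0_iff_equal)
    hence "t = 0"
      by simp
    moreover obtain x where "x\<^sup>2 = - n"
      using bij_square_char_2(2)[OF True] by (metis surjD)
    ultimately show False
      using no_root[of x] by simp
  next
    case False
    define x where "x = t / 2"
    have "t = 2 * x"
      using False by (simp add: x_def)
    hence "2 * (2 * (x\<^sup>2 - t * x + n)) = 0"
      using disc by Groebner_Basis.algebra
    thus False
      using no_root[of x] False by (simp only: mult_eq_0_iff simp_thms)
  qed
qed

text \<open>A common divisor divides the remainder \<open>R\<close>, so its degree is at most 1, and
  a linear one would give \<open>U\<close> a root.\<close>

lemma coprime_quadratic:
  fixes V U R :: "'a::field poly"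
  assumes U: "degree U = 2" "\<And>x. poly U x \<noteq> 0" and R: "R \<noteq> 0" "degree R \<le> 1"
    and V: "V = W * U + R"
  shows "coprime V U"
proof (rule coprimeI)
  fix d assume d: "d dvd V" "d dvd U"
  hence "d dvd V - W * U"
    by (intro dvd_diff dvd_mult)
  hence "d dvd R"
    by (simp add: V)
  hence deg: "degree d \<le> 1"
    using dvd_imp_degree_le[OF _ R(1)] R(2) by fastforce
  have "d \<noteq> 0"
    using \<open>d dvd R\<close> R(1) by auto
  have "degree d \<noteq> 1"
  proof
    assume "degree d = 1"
    then obtain c e where ce: "d = [:c, e:]" "e \<noteq> 0"
      using degree_le_3_eq[of d] coeff_degree_nonzero[of d 1] by (auto simp: coeff_eq_0)
    hence "poly d (- c / e) = 0"
      by simp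
    hence "poly U (- c / e) = 0"
      using d(2) by (auto elim!: dvdE)
    thus False
      using U(2) by blast
  qed
  thus "is_unit d"
    using deg \<open>d \<noteq> 0\<close> by (simp add: is_unit_iff_degree)
qed

text \<open>With \<open>U = x\<^sup>2 - t * x + n\<close> and
  \<open>\<alpha> = 4 * n - t\<^sup>2\<close>, the numerators are the coefficients of
  \<open>(a * x + b) * U + a * \<alpha> * (2 * x - t)\<close>: the affine images of the one
  normalized solution over each \<open>U\<close>.\<close>

lemma monic_PRF_pairs_3_2:
  assumes pp: "primepow (CARD('a::{field,finite}))" and q: "CARD('a) > 4"
  shows "(monic_PRF_pairs 3 2 :: ('a poly \<times> 'a poly) set) =
    (\<lambda>(a, b, t, n). ([:b * n - a * ((4 * n - t\<^sup>2) * t), a * (n + 2 * (4 * n - t\<^sup>2)) - b * t, b - a * t, a:],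
        [:n, - t, 1:])) ` ((UNIV - {0}) \<times> UNIV \<times> rootless_quadratics)" (is "_ = ?F ` _")
proof (intro Set.set_eqI iffI)
  fix p :: "'a poly \<times> 'a poly"
  assume p: "p \<in> monic_PRF_pairs 3 2"
  obtain V U where VU: "p = (V, U)" by (cases p)
  have deg: "degree U = 2" "degree V = 3" and lead: "lead_coeff U = 1" and cop: "coprime V U"
    and "bij (ratfun_eval V U)"
    using p by (auto simp: VU monic_PRF_pairs_def)
  hence no_root: "poly U x \<noteq> 0" and inj: "inj (\<lambda>x. poly V x / poly U x)" for x
    using bij_ratfun_eval_iff[of U V] by auto
  define t n a where tna: "t = - coeff U 1" "n = coeff U 0" "a = coeff V 3"
  have U_eq: "U = [:n, - t, 1:]"
    using deg lead degree_le_3_eq[of U] by (auto simp: tna coeff_eq_0)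
  have a: "a \<noteq> 0"
    using deg coeff_degree_nonzero[of V 3] by (simp add: tna)
  \<comment> \<open>Division by \<open>U\<close>:
    \<open>V = (a * x + b) * U + a * (r * x + s)\<close>.\<close>
  define b where "b = coeff V 2 + a * t"
  define r s where "r = (coeff V 1 + b * t) / a - n" and "s = (coeff V 0 - b * n) / a"
  have V_eq: "V = [:b * n + a * s, a * (n + r) - b * t, b - a * t, a:]"
    using degree_le_3_eq[of V] deg(2) a by (simp add: b_def r_def s_def tna(3))
  have U: "poly U x = x\<^sup>2 - t * x + n" for x
    by (simp add: U_eq algebra_simps power2_eq_square)
  have V: "poly V x / poly U x = a * (x + (r * x + s) / (x\<^sup>2 - t * x + n)) + b" for x
  proof -
    have "poly V x = (a * x + b) * (x\<^sup>2 - t * x + n) + a * (r * x + s)"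
      unfolding V_eq by simp Groebner_Basis.algebra
    thus ?thesis
      using no_root[of x] unfolding U by (simp add: field_simps)
  qed
  have "inj (\<lambda>x. x + (r * x + s) / (x\<^sup>2 - t * x + n))"
  proof (rule injI)
    fix x y
    assume "x + (r * x + s) / (x\<^sup>2 - t * x + n) = y + (r * y + s) / (y\<^sup>2 - t * y + n)"
    hence "poly V x / poly U x = poly V y / poly U y"
      by (simp only: V)
    thus "x = y"
      by (rule injD[OF inj])
  qed
  moreover have "r \<noteq> 0 \<or> s \<noteq> 0"
  proof (rule ccontr)
    assume "\<not> (r \<noteq> 0 \<or> s \<noteq> 0)"
    hence "V = [:b, a:] * U"
      by (simp add: V_eq U_eq algebra_simps)
    hence "U dvd V"
      by (simp only: dvd_triv_right)
    hence "is_unit U"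
      by (rule coprime_common_divisor[OF cop _ dvd_refl])
    moreover have "U \<noteq> 0"
      using deg(1) by auto
    ultimately show False
      using deg(1) by (simp add: is_unit_iff_degree)
  qed
  ultimately have rs: "r = 2 * (4 * n - t\<^sup>2)" "s = - (4 * n - t\<^sup>2) * t"
    using inj_imp_cubic_over_quadratic[OF pp q, of t n r s] no_root unfolding U by blast+
  have "p = ?F (a, b, t, n)"
    by (simp add: VU V_eq U_eq rs algebra_simps)
  moreover have "(t, n) \<in> rootless_quadratics"
    using no_root unfolding U rootless_quadratics_def by simp
  ultimately show "p \<in> ?F ` ((UNIV - {0}) \<times> UNIV \<times> rootless_quadratics)"
    using a by blast
next
  fix p :: "'a poly \<times> 'a poly"
  assume "p \<in> ?F ` ((UNIV - {0}) \<times> UNIV \<times> rootless_quadratics)"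
  then obtain a b t n where p: "p = ?F (a, b, t, n)" and a: "a \<noteq> 0" and tn: "(t, n) \<in> rootless_quadratics"
    by auto
  define \<alpha> where "\<alpha> = 4 * n - t\<^sup>2"
  define V where "V = [:b * n - a * (\<alpha> * t), a * (n + 2 * \<alpha>) - b * t, b - a * t, a:]"
  define U where "U = [:n, - t, 1:]"
  have VU: "p = (V, U)"
    by (simp add: p V_def U_def \<alpha>_def)
  have U: "poly U x = x\<^sup>2 - t * x + n" for x
    by (simp add: U_def algebra_simps power2_eq_square)
  have no_root: "poly U x \<noteq> 0" for x
    using tn by (simp add: U rootless_quadratics_def)
  have V: "poly V x / poly U x = a * (x + (2 * \<alpha> * x - \<alpha> * t) / (x\<^sup>2 - t * x + n)) + b" for x
  proof -
    have "poly V x = (a * x + b) * (x\<^sup>2 - t * x + n) + a * (2 * \<alpha> * x - \<alpha> * t)"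
      unfolding V_def by simp Groebner_Basis.algebra
    thus ?thesis
      using no_root[of x] unfolding U by (simp add: field_simps)
  qed
  have "inj (\<lambda>x. poly V x / poly U x)"
  proof (rule injI)
    fix x y assume "poly V x / poly U x = poly V y / poly U y"
    hence "x + (2 * \<alpha> * x - \<alpha> * t) / (x\<^sup>2 - t * x + n) = y + (2 * \<alpha> * y - \<alpha> * t) / (y\<^sup>2 - t * y + n)"
      using a by (simp add: V)
    thus "x = y"
      using cubic_over_quadratic_inj[of t n, THEN injD, of x y] no_root by (simp add: \<alpha>_def U)
  qed
  hence "bij (ratfun_eval V U)"
    using no_root a by (subst bij_ratfun_eval_iff) (auto simp: V_def U_def)
  moreover have "coprime V U"
  proof (rule coprime_quadratic)
    have "\<alpha> \<noteq> 0"
      using rootless_quadratic_discriminant[OF tn] by (simp add: \<alpha>_def)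
    have "\<alpha> * t \<noteq> 0 \<or> 2 * \<alpha> \<noteq> 0"
    proof (rule ccontr)
      assume "\<not> (\<alpha> * t \<noteq> 0 \<or> 2 * \<alpha> \<noteq> 0)"
      hence zero: "\<alpha> * t = 0" "2 * \<alpha> = 0"
        by blast+
      \<comment> \<open>In characteristic 2 the coefficient \<open>2 * \<alpha>\<close> is zero. The
        identity combines both coefficients, so they cannot vanish together in any
        characteristic.\<close>
      have "\<alpha> * \<alpha> = 2 * \<alpha> * (2 * n) - \<alpha> * t * t"
        unfolding \<alpha>_def by Groebner_Basis.algebra
      hence "\<alpha> * \<alpha> = 0"
        by (simp only: zero mult_zero_left diff_self)
      thus False
        using \<open>\<alpha> \<noteq> 0\<close> by simp
    qed
    thus "[:- (a * (\<alpha> * t)), a * (2 * \<alpha>):] \<noteq> 0"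
      using a by auto
    show "V = [:b, a:] * U + [:- (a * (\<alpha> * t)), a * (2 * \<alpha>):]"
      by (simp add: V_def U_def algebra_simps)
    show "poly U x \<noteq> 0" for x
      by (rule no_root)
  qed (simp_all add: U_def)
  ultimately show "p \<in> monic_PRF_pairs 3 2"
    using a by (auto simp: VU monic_PRF_pairs_def V_def U_def)
qed

lemma card_PRF_3_2:
  assumes "primepow (CARD('a::{field,finite}))" "CARD('a) > 4"
  shows "2 * card (monic_PRF_pairs 3 2 :: ('a poly \<times> 'a poly) set) = (CARD('a) * (CARD('a) - 1))\<^sup>2"
proof -
  have "inj_on (\<lambda>(a, b, t, n). ([:b * n - a * ((4 * n - t\<^sup>2) * t), a * (n + 2 * (4 * n - t\<^sup>2)) - b * t, b - a * t, a:],
        [:n, - t, 1:])) ((UNIV - {0 :: 'a}) \<times> UNIV \<times> rootless_quadratics)"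
    by (auto intro!: inj_onI)
  hence "card (monic_PRF_pairs 3 2 :: ('a poly \<times> 'a poly) set) =
      (CARD('a) - 1) * (CARD('a) * card (rootless_quadratics :: ('a \<times> 'a) set))"
    unfolding monic_PRF_pairs_3_2[OF assms] by (simp add: card_image card_cartesian_product)
  thus ?thesis
    using card_rootless_quadratics[where ?'a = 'a] by (simp add: power2_eq_square mult_ac)
qed

section \<open>The value of the sum and the bound\<close>

text \<open>The pairs (0,0), (2,1) and (3,1) contribute nothing, while (0,1) and (1,0) contribute
  equally.\<close>

lemma PRF_sum_5_eq:
  "PRF_sum TYPE('a::{field,finite}) 5 = (CARD('a) - 1)\<^sup>2 * CARD('a) + 2 * ((CARD('a) - 1) * CARD('a)) +
     (if (2 :: 'a) = 0 then (CARD('a) - 1) * CARD('a) else 0) +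
     card (monic_PRF_pairs 3 0 :: ('a poly \<times> 'a poly) set) +
     card (monic_PRF_pairs 3 2 :: ('a poly \<times> 'a poly) set)"
  unfolding PRF_sum_def PRF_degrees_5 PRF_count_eq
  using card_PRF_0_0[where ?'a = 'a] card_PRF_1_1[where ?'a = 'a] card_PRF_0_1[where ?'a = 'a]
    card_PRF_1_0[where ?'a = 'a] card_PRF_2_0[where ?'a = 'a]
    card_PRF_linear_denominator[of 2, where ?'a = 'a] card_PRF_linear_denominator[of 3, where ?'a = 'a]
  by simp

lemma two_three_nonzero:
  assumes "(2 :: 'a::comm_ring_1) = 0" "(3 :: 'a) = 0"
  shows False
proof -
  have "(1 :: 'a) = 3 - 2" by simp
  thus False
    unfolding assms by simp
qed

lemma real_PRF_sum_5_eq: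
  assumes "primepow (CARD('a::{field,finite}))" "CARD('a) > 4"
  defines "q \<equiv> real (CARD('a))"
  shows "real (PRF_sum TYPE('a) 5) = q ^ 3 - q + (if even (CARD('a)) then q\<^sup>2 - q else 0) +
     (if CARD('a) mod 3 = 0 then (q ^ 3 - q) / 2
      else if CARD('a) mod 3 = 1 then 0 else q ^ 3 - q\<^sup>2) + (q * (q - 1))\<^sup>2 / 2"
proof -
  have q: "real (CARD('a) - 1) = q - 1"
    using assms(2) by (simp add: q_def)
  have two: "(2 :: 'a) = 0 \<longleftrightarrow> even (CARD('a))" and three: "(3 :: 'a) = 0 \<longleftrightarrow> CARD('a) mod 3 = 0"
    using CHAR_dvd_card_iff[OF assms(1), of 2] CHAR_dvd_card_iff[OF assms(1), of 3]
    by (auto simp: dvd_eq_mod_eq_0)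
  have "2 * real (card (monic_PRF_pairs 3 2 :: ('a poly \<times> 'a poly) set)) = (q * (q - 1))\<^sup>2"
    using arg_cong[OF card_PRF_3_2[OF assms(1,2)], of real] by (simp add: q q_def)
  moreover have "real (card (monic_PRF_pairs 3 0 :: ('a poly \<times> 'a poly) set)) =
     (if CARD('a) mod 3 = 0 then (q ^ 3 - q) / 2 else if CARD('a) mod 3 = 1 then 0 else q ^ 3 - q\<^sup>2)"
  proof -
    have "CARD('a) mod 3 = 0 \<or> CARD('a) mod 3 = 1 \<or> CARD('a) mod 3 = 2"
      by arith
    then consider "CARD('a) mod 3 = 0" | "CARD('a) mod 3 = 1" | "CARD('a) mod 3 = 2"
      by (elim disjE) auto
    thus ?thesis
    proof cases
      case 1
      hence "(3 :: 'a) = 0"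
        by (simp add: three)
      moreover have "(2 :: 'a) \<noteq> 0"
        using two_three_nonzero \<open>(3 :: 'a) = 0\<close> by blast
      ultimately have "real (2 * card (monic_PRF_pairs 3 0 :: ('a poly \<times> 'a poly) set)) =
          real ((CARD('a) - 1) * (CARD('a) + 1) * CARD('a))"
        by (simp only: card_PRF_3_0_char_3 not_False_eq_True)
      hence "2 * real (card (monic_PRF_pairs 3 0 :: ('a poly \<times> 'a poly) set)) = (q - 1) * (q + 1) * q"
        by (simp only: of_nat_mult of_nat_add q of_nat_1 of_nat_numeral flip: q_def)
      thus ?thesis
        using 1 by (simp add: algebra_simps power3_eq_cube)
    next
      case 2
      thus ?thesis
        using card_PRF_3_0_mod_1[where ?'a = 'a] assms(2) by simp
    next
      case 3
      hence "card (monic_PRF_pairs 3 0 :: ('a poly \<times> 'a poly) set) = (CARD('a) - 1) * (CARD('a))\<^sup>2"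
        using assms(2) three by (intro card_PRF_3_0_mod_2) auto
      thus ?thesis
        using 3 by (simp add: q power2_eq_square power3_eq_cube algebra_simps flip: q_def)
    qed
  qed
  moreover have "real (PRF_sum TYPE('a) 5) = (q - 1)\<^sup>2 * q + 2 * ((q - 1) * q) +
      (if even (CARD('a)) then (q - 1) * q else 0) +
      real (card (monic_PRF_pairs 3 0 :: ('a poly \<times> 'a poly) set)) +
      real (card (monic_PRF_pairs 3 2 :: ('a poly \<times> 'a poly) set))"
    by (simp only: PRF_sum_5_eq two of_nat_add of_nat_mult of_nat_power of_nat_numeral q
        if_distrib[of real] of_nat_0 flip: q_def)
  \<comment> \<open>Degrees (1,1), (0,1) and (1,0) together form all q^3 - q Moebius
    transformations.\<close>
  moreover have "(q - 1)\<^sup>2 * q + 2 * ((q - 1) * q) = q ^ 3 - q" "(q - 1) * q = q\<^sup>2 - q"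
    by (simp_all add: power2_eq_square power3_eq_cube algebra_simps)
  ultimately show ?thesis
    by simp
qed

theorem theorem4p6:
  fixes q :: nat
  assumes "primepow q" and "q > 7"
    and "card (UNIV :: 'a::{field,finite} set) = q"
  shows "max_perm_array q (q - 5) \<ge> PRF_sum TYPE('a) 5 \<and>
    (q mod 3 = 0 \<longrightarrow>
       real (PRF_sum TYPE('a) 5) = 1/2 * (real q ^ 4 + real q ^ 3 + real q ^ 2 - 3 * real q)) \<and>
    (odd q \<and> q mod 3 = 1 \<longrightarrow>
       real (PRF_sum TYPE('a) 5) = 1/2 * (real q ^ 4 + real q ^ 2 - 2 * real q)) \<and>
    (even q \<and> q mod 3 = 1 \<longrightarrow>
       real (PRF_sum TYPE('a) 5) = 1/2 * (real q ^ 4 + 3 * real q ^ 2 - 4 * real q)) \<and>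
    (odd q \<and> q mod 3 = 2 \<longrightarrow>
       real (PRF_sum TYPE('a) 5) = 1/2 * (real q ^ 4 + 2 * real q ^ 3 - real q ^ 2 - 2 * real q)) \<and>
    (even q \<and> q mod 3 = 2 \<longrightarrow>
       real (PRF_sum TYPE('a) 5) = 1/2 * (real q ^ 4 + 2 * real q ^ 3 + real q ^ 2 - 4 * real q))"
proof -
  have pp: "primepow (CARD('a))"
    using assms by simp
  \<comment> \<open>The value for multiples of 3 makes no parity distinction: 2 and 3 cannot both
    vanish in a field, so q is odd and the summand \<open>q\<^sup>2 - q\<close> is absent.\<close>
  have odd: "q mod 3 = 0 \<longrightarrow> odd q"
  proof (intro impI notI)
    assume "q mod 3 = 0" "even q"
    hence "(2 :: 'a) = 0" "(3 :: 'a) = 0"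
      using CHAR_dvd_card_iff[OF pp, of 2] CHAR_dvd_card_iff[OF pp, of 3] assms(3)
      by (simp_all add: dvd_eq_mod_eq_0)
    thus False
      by (rule two_three_nonzero)
  qed
  have "(real q * (real q - 1))\<^sup>2 = real q ^ 4 - 2 * real q ^ 3 + (real q)\<^sup>2"
    by (simp add: algebra_simps power2_eq_square power3_eq_cube power4_eq_xxxx)
  hence sum: "real (PRF_sum TYPE('a) 5) = real q ^ 3 - real q + (if even q then (real q)\<^sup>2 - real q else 0) +
     (if q mod 3 = 0 then (real q ^ 3 - real q) / 2
      else if q mod 3 = 1 then 0 else real q ^ 3 - (real q)\<^sup>2) +
     (real q ^ 4 - 2 * real q ^ 3 + (real q)\<^sup>2) / 2"
    using real_PRF_sum_5_eq[OF pp] assms(2) unfolding assms(3) by (simp only:)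
  show ?thesis
  proof (intro conjI impI)
    show "PRF_sum TYPE('a) 5 \<le> max_perm_array q (q - 5)"
      using PRF_sum_le_max_perm_array[where ?'a = 'a] assms(2,3) by simp
  qed (use odd in \<open>simp_all add: sum add_divide_distrib diff_divide_distrib\<close>)
qed

end
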